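(* Let $M$ be a smooth $n$-manifold with a fixed smooth inner product (Riemannian metric) $g$ on $TM$, let $B\in\mathrm{Aut}(\Gamma(TM))$ be orthogonal, and let $$L_B=\{((I+B)X,\,(I-B)\omega_X)\;:\;X\in\Gamma(TM)\}$$ be the associated Dirac structure on $TM$. Then the following are equivalent: (a) for all $(X,\omega),(Y,\mu)\in L_B$ one has $([X,Y],\{\omega,\mu\})\in L_B$, where $\{\omega,\mu\}=X(d\mu)-Y(d\omega)+\frac12 d\big(X(\mu)-Y(\omega)\big)$; (b) for all $X,Y\in\Gamma(TM)$, $$(I+B)\{(I-B)\omega_X,(I-B)\omega_Y\}=(I-B)[(I+B)X,(I+B)Y],$$ where $\{(I-B)\omega_X,(I-B)\omega_Y\}$ is the bracket of (a) formed for the pair $((I+B)X,(I-B)\omega_X)$, $((I+B)Y,(I-B)\omega_Y)$ of elements of $L_B$, and both sides are compared via the identification of $TM$ with $T^*M$ given by $g$.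
   Context: $\Gamma$ denotes smooth sections. The inner product $g$ identifies $TM$ with $T^*M$: for $X\in\Gamma(TM)$, $\omega_X\in\Gamma(T^*M)$ is the dual form $\omega_X=g(X,\cdot)$. $\mathrm{Aut}(\Gamma(TM))$ is the group of automorphisms of $\Gamma(TM)$ as a module over $C^\infty(M)$. $B$ is orthogonal if $g(BX,BY)=g(X,Y)$ for all $X,Y$. Via the identification, $B$ acts also on $\Gamma(T^*M)$ by $B\omega_X=\omega_{BX}$. A Dirac structure on $TM$ is a smooth subbundle of $TM\oplus T^*M$ (identified with its module of sections) that is maximally isotropic under the pairing $\langle (X,\omega),(Y,\mu)\rangle_+=\frac12(\mu(X)+\omega(Y))$; $L_B$ is one for every orthogonal $B$. For a vector field $X$ and a form $\mu$, $X(\mu)=\mu(X)$ when $\mu$ is a 1-form, and $X(d\mu)=i_X d\mu=d\mu(X,\cdot)$ is contraction. $[\cdot,\cdot]$ is the Lie bracket of vector fields. The bracket $\{\omega,\mu\}$ depends on the vector fields $X,Y$ paired with $\omega,\mu$. (a) and (b) are the paper's two definitions of "$L_B$ is integrable". *)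

theory Defs
  imports "HOL-Analysis.Analysis" "HOL-Library.Function_Algebras"
begin

section \<open>Smooth manifolds\<close>

text \<open>Meant for open \<open>S\<close>; there, in finite dimension, \<open>Ck_on k S f\<close> says that \<open>f\<close> is
  \<open>k\<close> times continuously differentiable.\<close>

primrec Ck_on ::
  "nat \<Rightarrow> 'a::real_normed_vector set \<Rightarrow> ('a \<Rightarrow> 'b::real_normed_vector) \<Rightarrow> bool" where
  "Ck_on 0 S f \<longleftrightarrow> continuous_on S f"
| "Ck_on (Suc k) S f \<longleftrightarrow>
     (\<forall>x\<in>S. f differentiable (at x)) \<and>
     (\<forall>v. Ck_on k S (\<lambda>x. frechet_derivative f (at x) v))"

definition smooth_on ::
  "'a::real_normed_vector set \<Rightarrow> ('a \<Rightarrow> 'b::real_normed_vector) \<Rightarrow> bool" where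
  "smooth_on S f \<longleftrightarrow> (\<forall>k. Ck_on k S f)"

text \<open>A chart is a pair of its domain and its coordinate map. The dimension of the manifold is
  \<open>DIM('e)\<close>, where \<open>'e\<close> is the Euclidean model space.\<close>

type_synonym ('m, 'e) chart = "'m set \<times> ('m \<Rightarrow> 'e)"
type_synonym ('m, 'e) atlas = "('m, 'e) chart set"

abbreviation chart_dom :: "('m, 'e) chart \<Rightarrow> 'm set" where
  "chart_dom c \<equiv> fst c"

abbreviation chart_map :: "('m, 'e) chart \<Rightarrow> 'm \<Rightarrow> 'e" where
  "chart_map c \<equiv> snd c"

abbreviation chart_range :: "('m, 'e) chart \<Rightarrow> 'e set" where
  "chart_range c \<equiv> chart_map c ` chart_dom c"

abbreviation chart_inv :: "('m, 'e) chart \<Rightarrow> 'e \<Rightarrow> 'm" where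
  "chart_inv c \<equiv> inv_into (chart_dom c) (chart_map c)"

abbreviation transition :: "('m, 'e) chart \<Rightarrow> ('m, 'e) chart \<Rightarrow> 'e \<Rightarrow> 'e" where
  "transition c c' \<equiv> chart_map c' \<circ> chart_inv c"

definition is_chart :: "'m topology \<Rightarrow> ('m, 'e::euclidean_space) chart \<Rightarrow> bool" where
  "is_chart M c \<longleftrightarrow>
     openin M (chart_dom c) \<and> open (chart_range c) \<and>
     homeomorphic_map (subtopology M (chart_dom c)) (top_of_set (chart_range c)) (chart_map c)"

text \<open>The atlas need not be maximal; it generates the smooth structure.\<close>

definition smooth_manifold :: "'m topology \<Rightarrow> ('m, 'e::euclidean_space) atlas \<Rightarrow> bool" where
  "smooth_manifold M A \<longleftrightarrow>
     Hausdorff_space M \<and> second_countable M \<and>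
     (\<forall>c\<in>A. is_chart M c) \<and> topspace M = (\<Union>c\<in>A. chart_dom c) \<and>
     (\<forall>c\<in>A. \<forall>c'\<in>A.
        smooth_on (chart_map c ` (chart_dom c \<inter> chart_dom c')) (transition c c'))"

abbreviation points :: "('m, 'e) atlas \<Rightarrow> 'm set" where
  "points A \<equiv> \<Union>c\<in>A. chart_dom c"

definition charts_at :: "('m, 'e) atlas \<Rightarrow> 'm \<Rightarrow> ('m, 'e) chart set" where
  "charts_at A p = {c \<in> A. p \<in> chart_dom c}"

definition some_chart :: "('m, 'e) atlas \<Rightarrow> 'm \<Rightarrow> ('m, 'e) chart" where
  "some_chart A p = (SOME c. c \<in> charts_at A p)"

definition smooth_functions :: "('m, 'e::euclidean_space) atlas \<Rightarrow> ('m \<Rightarrow> real) set" where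
  "smooth_functions A = {f. \<forall>c\<in>A. smooth_on (chart_range c) (f \<circ> chart_inv c)}"


section \<open>Tangent vectors, vector fields and forms\<close>

text \<open>A tangent vector at \<open>p\<close> is given by its components \<open>v c\<close> in all charts \<open>c\<close> around \<open>p\<close>,
  subject to the usual transformation law. Components in all other charts are \<open>0\<close>, so that
  equality of tangent vectors is equality of functions; for \<open>p \<notin> points A\<close> the only element of
  \<open>tangent_space A p\<close> is \<open>0\<close>.\<close>

type_synonym ('m, 'e) tvec = "('m, 'e) chart \<Rightarrow> 'e"

definition tangent_space :: "('m, 'e::euclidean_space) atlas \<Rightarrow> 'm \<Rightarrow> ('m, 'e) tvec set" where
  "tangent_space A p =
     {v. (\<forall>c. c \<notin> charts_at A p \<longrightarrow> v c = 0) \<and>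
         (\<forall>c\<in>charts_at A p. \<forall>c'\<in>charts_at A p.
            v c' = frechet_derivative (transition c c') (at (chart_map c p)) (v c))}"

definition tscale :: "real \<Rightarrow> ('m, 'e::euclidean_space) tvec \<Rightarrow> ('m, 'e) tvec" where
  "tscale r v = (\<lambda>c. r *\<^sub>R v c)"

text \<open>The tangent vector at \<open>p\<close> whose component in the chart \<open>c\<close> is \<open>u\<close>; for basis vectors \<open>u\<close>
  these are the coordinate vectors \<open>\<partial>/\<partial>x\<^sub>i\<close>.\<close>

definition coord_vec ::
  "('m, 'e::euclidean_space) atlas \<Rightarrow> ('m, 'e) chart \<Rightarrow> 'm \<Rightarrow> 'e \<Rightarrow> ('m, 'e) tvec" where
  "coord_vec A c p u =
     (\<lambda>c'. if c' \<in> charts_at A p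
           then frechet_derivative (transition c c') (at (chart_map c p)) u else 0)"

type_synonym ('m, 'e) vfield = "'m \<Rightarrow> ('m, 'e) tvec"

definition vector_fields :: "('m, 'e::euclidean_space) atlas \<Rightarrow> ('m, 'e) vfield set" where
  "vector_fields A =
     {X. (\<forall>p. X p \<in> tangent_space A p) \<and>
         (\<forall>c\<in>A. smooth_on (chart_range c) (\<lambda>x. X (chart_inv c x) c))}"

definition fun_scale ::
  "('m \<Rightarrow> real) \<Rightarrow> ('m, 'e::euclidean_space) vfield \<Rightarrow> ('m, 'e) vfield" where
  "fun_scale f X = (\<lambda>p. tscale (f p) (X p))"

text \<open>A 1-form assigns to each \<open>p\<close> a linear functional on \<open>tangent_space A p\<close>, extended by \<open>0\<close>
  off that space.\<close>

type_synonym ('m, 'e) form = "'m \<Rightarrow> ('m, 'e) tvec \<Rightarrow> real"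

definition restrict_form :: "('m, 'e::euclidean_space) atlas \<Rightarrow> ('m, 'e) form \<Rightarrow> ('m, 'e) form"
  where "restrict_form A \<alpha> =
     (\<lambda>p v. if p \<in> points A \<and> v \<in> tangent_space A p then \<alpha> p v else 0)"

definition one_forms :: "('m, 'e::euclidean_space) atlas \<Rightarrow> ('m, 'e) form set" where
  "one_forms A =
     {\<alpha>. restrict_form A \<alpha> = \<alpha> \<and>
         (\<forall>p\<in>points A. \<forall>v\<in>tangent_space A p. \<forall>w\<in>tangent_space A p. \<forall>r.
            \<alpha> p (v + w) = \<alpha> p v + \<alpha> p w \<and> \<alpha> p (tscale r v) = r * \<alpha> p v) \<and>
         (\<forall>c\<in>A. \<forall>u. smooth_on (chart_range c)
            (\<lambda>x. \<alpha> (chart_inv c x) (coord_vec A c (chart_inv c x) u)))}"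

definition pairing :: "('m, 'e) form \<Rightarrow> ('m, 'e) vfield \<Rightarrow> 'm \<Rightarrow> real" where
  "pairing \<mu> X = (\<lambda>p. \<mu> p (X p))"

text \<open>The formula for \<open>df\<close> is independent of the chart by the chain rule.\<close>

definition differential :: "('m, 'e::euclidean_space) atlas \<Rightarrow> ('m \<Rightarrow> real) \<Rightarrow> ('m, 'e) form" where
  "differential A f = restrict_form A (\<lambda>p v.
     let c = some_chart A p
     in frechet_derivative (f \<circ> chart_inv c) (at (chart_map c p)) (v c))"

text \<open>The 1-form \<open>X(d\<mu>) = i\<^sub>X d\<mu>\<close>, where, in a chart (which one is irrelevant), \<open>d\<mu>\<close> has the
  components \<open>\<partial>\<^sub>i \<mu>\<^sub>j - \<partial>\<^sub>j \<mu>\<^sub>i\<close>. The normalisation is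
  \<open>d\<mu>(X,Y) = X(\<mu>(Y)) - Y(\<mu>(X)) - \<mu>([X,Y])\<close>, without a factor \<open>1/2\<close>.\<close>

definition ext_deriv ::
  "('m, 'e::euclidean_space) atlas \<Rightarrow> ('m, 'e) form \<Rightarrow> 'm \<Rightarrow> ('m, 'e) tvec \<Rightarrow> ('m, 'e) tvec \<Rightarrow> real"
  where "ext_deriv A \<mu> p v w =
     (let c = some_chart A p;
          comp = (\<lambda>u x. \<mu> (chart_inv c x) (coord_vec A c (chart_inv c x) u))
      in frechet_derivative (comp (w c)) (at (chart_map c p)) (v c)
       - frechet_derivative (comp (v c)) (at (chart_map c p)) (w c))"

definition contract_ext_deriv ::
  "('m, 'e::euclidean_space) atlas \<Rightarrow> ('m, 'e) vfield \<Rightarrow> ('m, 'e) form \<Rightarrow> ('m, 'e) form" where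
  "contract_ext_deriv A X \<mu> = restrict_form A (\<lambda>p v. ext_deriv A \<mu> p (X p) v)"

text \<open>In every chart, \<open>[X,Y]\<^sup>i = X\<^sup>j \<partial>\<^sub>j Y\<^sup>i - Y\<^sup>j \<partial>\<^sub>j X\<^sup>i\<close>, i.e. \<open>[X,Y] f = X(Y f) - Y(X f)\<close>.\<close>

definition lie_bracket ::
  "('m, 'e::euclidean_space) atlas \<Rightarrow> ('m, 'e) vfield \<Rightarrow> ('m, 'e) vfield \<Rightarrow> ('m, 'e) vfield" where
  "lie_bracket A X Y = (\<lambda>p c.
     if c \<in> charts_at A p
     then frechet_derivative (\<lambda>x. Y (chart_inv c x) c) (at (chart_map c p)) (X p c)
        - frechet_derivative (\<lambda>x. X (chart_inv c x) c) (at (chart_map c p)) (Y p c)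
     else 0)"


section \<open>Riemannian metrics and orthogonal automorphisms\<close>

type_synonym ('m, 'e) metric = "'m \<Rightarrow> ('m, 'e) tvec \<Rightarrow> ('m, 'e) tvec \<Rightarrow> real"

definition riemannian_metric ::
  "('m, 'e::euclidean_space) atlas \<Rightarrow> ('m, 'e) metric \<Rightarrow> bool" where
  "riemannian_metric A g \<longleftrightarrow>
     (\<forall>p\<in>points A. \<forall>u\<in>tangent_space A p. \<forall>v\<in>tangent_space A p. \<forall>w\<in>tangent_space A p. \<forall>r.
        g p u v = g p v u \<and>
        g p (u + v) w = g p u w + g p v w \<and>
        g p (tscale r u) v = r * g p u v \<and>
        (u \<noteq> 0 \<longrightarrow> g p u u > 0)) \<and>
     (\<forall>c\<in>A. \<forall>u w. smooth_on (chart_range c)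
        (\<lambda>x. g (chart_inv c x) (coord_vec A c (chart_inv c x) u)
                                (coord_vec A c (chart_inv c x) w)))"

definition flat ::
  "('m, 'e::euclidean_space) atlas \<Rightarrow> ('m, 'e) metric \<Rightarrow> ('m, 'e) vfield \<Rightarrow> ('m, 'e) form" where
  "flat A g X = restrict_form A (\<lambda>p v. g p (X p) v)"

text \<open>Only used on \<open>one_forms A\<close>, onto which \<open>flat A g\<close> maps \<open>vector_fields A\<close> bijectively.\<close>

definition sharp ::
  "('m, 'e::euclidean_space) atlas \<Rightarrow> ('m, 'e) metric \<Rightarrow> ('m, 'e) form \<Rightarrow> ('m, 'e) vfield" where
  "sharp A g \<alpha> = (THE X. X \<in> vector_fields A \<and> flat A g X = \<alpha>)"

definition module_automorphism ::
  "('m, 'e::euclidean_space) atlas \<Rightarrow> (('m, 'e) vfield \<Rightarrow> ('m, 'e) vfield) \<Rightarrow> bool" where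
  "module_automorphism A B \<longleftrightarrow>
     bij_betw B (vector_fields A) (vector_fields A) \<and>
     (\<forall>X\<in>vector_fields A. \<forall>Y\<in>vector_fields A. B (X + Y) = B X + B Y) \<and>
     (\<forall>f\<in>smooth_functions A. \<forall>X\<in>vector_fields A. B (fun_scale f X) = fun_scale f (B X))"

definition orthogonal_automorphism ::
  "('m, 'e::euclidean_space) atlas \<Rightarrow> ('m, 'e) metric
     \<Rightarrow> (('m, 'e) vfield \<Rightarrow> ('m, 'e) vfield) \<Rightarrow> bool" where
  "orthogonal_automorphism A g B \<longleftrightarrow>
     module_automorphism A B \<and>
     (\<forall>X\<in>vector_fields A. \<forall>Y\<in>vector_fields A. \<forall>p\<in>points A.
        g p (B X p) (B Y p) = g p (X p) (Y p))"

text \<open>The action \<open>B \<omega>\<^sub>X = \<omega>\<^bsub>BX\<^esub>\<close> on 1-forms.\<close>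

definition form_action ::
  "('m, 'e::euclidean_space) atlas \<Rightarrow> ('m, 'e) metric
     \<Rightarrow> (('m, 'e) vfield \<Rightarrow> ('m, 'e) vfield) \<Rightarrow> ('m, 'e) form \<Rightarrow> ('m, 'e) form" where
  "form_action A g B \<alpha> = flat A g (B (sharp A g \<alpha>))"


section \<open>The Dirac structure of an orthogonal automorphism\<close>

definition dirac_structure ::
  "('m, 'e::euclidean_space) atlas \<Rightarrow> ('m, 'e) metric
     \<Rightarrow> (('m, 'e) vfield \<Rightarrow> ('m, 'e) vfield) \<Rightarrow> (('m, 'e) vfield \<times> ('m, 'e) form) set" where
  "dirac_structure A g B =
     {(X + B X, flat A g X - form_action A g B (flat A g X)) | X. X \<in> vector_fields A}"

text \<open>\<open>form_bracket A (X, \<omega>) (Y, \<mu>)\<close> is \<open>{\<omega>, \<mu>}\<close>, which also depends on \<open>X\<close> and \<open>Y\<close>.\<close>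

definition form_bracket ::
  "('m, 'e::euclidean_space) atlas \<Rightarrow> ('m, 'e) vfield \<times> ('m, 'e) form
     \<Rightarrow> ('m, 'e) vfield \<times> ('m, 'e) form \<Rightarrow> ('m, 'e) form" where
  "form_bracket A = (\<lambda>(X, \<omega>) (Y, \<mu>).
     contract_ext_deriv A X \<mu> - contract_ext_deriv A Y \<omega>
     + (\<lambda>p v. 1/2 * differential A (pairing \<mu> X - pairing \<omega> Y) p v))"

end

theory Submission
  imports Defs
begin

text \<open>
  For a vector field \<open>Z\<close> and a 1-form \<open>\<beta> = \<omega>\<^sub>W\<close>, membership of \<open>(Z, \<beta>)\<close> in \<open>L\<^sub>B\<close> means that
  \<open>Z = (I + B)X\<close> and \<open>W = (I - B)X\<close> for some \<open>X\<close>. As \<open>I + B\<close> and \<open>I - B\<close> commute, this implies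
  \<open>(I + B)W = (I - B)Z\<close>; conversely, that equation makes \<open>X = (Z + W)/2\<close> a witness. So the two
  conditions agree pairwise, provided that the Lie bracket is a vector field, that the bracket of
  forms is a 1-form, and that every 1-form is some \<open>\<omega>\<^sub>W\<close>. The first two rest on the symmetry of
  second derivatives of the chart transitions, the third on solving a symmetric positive definite
  linear system smoothly in its coefficients.
\<close>

subsection \<open>Calculus of smooth maps\<close>

text \<open>The equation \<open>Z = (I + B)X\<close> cannot be solved for X in general: I + B may be
  singular, and B = -I even makes it zero. But the pair (Z, W) recovers X, since Z + W = 2X, and so
  membership comes down to one equation between Z and W. Second derivatives enter because the Lie
  bracket and d\<mu> are both built from derivatives of chart components. A change of chart adds a
  term with the second derivative of the transition, evaluated on the two vectors involved;
  antisymmetrisation removes it exactly because that derivative is symmetric. A recurring obstacle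
  is that \<open>Ck_on\<close> speaks of derivatives in fixed directions only, while the chain rule
  and all tensor expressions insert vectors that vary with the point. Expansion in
  \<open>Basis\<close> turns these into finite sums of products. For the same reason the linear
  system is solved by sums, products and reciprocals of positive functions, each of which visibly
  preserves smoothness.\<close>

abbreviation fd :: "('a::real_normed_vector \<Rightarrow> 'b::real_normed_vector) \<Rightarrow> 'a \<Rightarrow> 'a \<Rightarrow> 'b" where
  "fd f x \<equiv> frechet_derivative f (at x)"

lemma fd_eqI: "(f has_derivative f') (at x) \<Longrightarrow> fd f x = f'"
  by (rule frechet_derivative_at[symmetric])

text \<open>\<open>frechet_derivative\<close> is a choice among all derivatives at x, and which maps
  are derivatives depends only on the values near x. The equality thus holds even where nothing is
  differentiable.\<close>

lemma fd_cong_open: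
  assumes "open S" "x \<in> S" "\<And>y. y \<in> S \<Longrightarrow> f y = g y"
  shows "fd f x = fd g x"
proof -
  have "(f has_derivative D) (at x) \<longleftrightarrow> (g has_derivative D) (at x)" for D
    by (metis assms has_derivative_transform_within_open)
  then show ?thesis unfolding frechet_derivative_def by simp
qed

text \<open>Openness of S lets the agreement pass to derivatives, which then agree on S as well;
  hence the induction over all f and g. It matters because chart inverses have arbitrary values
  outside the chart range.\<close>

lemma Ck_on_cong:
  assumes "open S" "\<And>x. x \<in> S \<Longrightarrow> f x = g x" "Ck_on k S f"
  shows "Ck_on k S g"
  using assms(2,3)
proof (induction k arbitrary: f g)
  case 0
  then show ?case by (simp cong: continuous_on_cong)
next
  case (Suc k)
  have "g differentiable (at x)" if "x \<in> S" for x
    using Suc.prems that assms(1)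
    by (metis Ck_on.simps(2) differentiable_def has_derivative_transform_within_open)
  moreover have "Ck_on k S (\<lambda>x. fd g x v)" for v
  proof (rule Suc.IH)
    show "fd f x v = fd g x v" if "x \<in> S" for x
      using fd_cong_open[OF assms(1) that Suc.prems(1)] by simp
    show "Ck_on k S (\<lambda>x. fd f x v)" using Suc.prems by simp
  qed
  ultimately show ?case by simp
qed

lemma Ck_on_subset: "Ck_on k S f \<Longrightarrow> T \<subseteq> S \<Longrightarrow> Ck_on k T f"
  by (induction k arbitrary: f) (auto intro: continuous_on_subset)

lemma Ck_on_SucD: "Ck_on (Suc k) S f \<Longrightarrow> Ck_on k S f"
proof (induction k arbitrary: f)
  case 0
  then show ?case
    by (auto intro!: differentiable_imp_continuous_on differentiable_at_imp_differentiable_on)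
qed simp

section \<open>Closure of k times continuously differentiable maps under algebra and
  composition\<close>

lemma Ck_on_const: "Ck_on k S (\<lambda>x. c)"
  by (induction k arbitrary: c) (auto simp: continuous_on_const)

lemma Ck_on_has_derivative: "Ck_on (Suc k) S f \<Longrightarrow> x \<in> S \<Longrightarrow> (f has_derivative fd f x) (at x)"
  by (simp flip: frechet_derivative_works)

text \<open>The induction step shared by all closure lemmas below: a derivative formula valid on S
  suffices. The direction comes first in \<open>f'\<close> so that \<open>f' v\<close> is a function
  of the base point.\<close>

lemma Ck_on_SucI:
  assumes "open S" "\<And>x. x \<in> S \<Longrightarrow> (f has_derivative (\<lambda>v. f' v x)) (at x)"
    and "\<And>v. Ck_on k S (f' v)"
  shows "Ck_on (Suc k) S f"
proof -
  have "Ck_on k S (\<lambda>x. fd f x v)" for v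
    by (rule Ck_on_cong[OF assms(1) _ assms(3)[of v]]) (simp add: fd_eqI[OF assms(2)])
  then show ?thesis using assms(2) by (auto simp: differentiable_def)
qed

lemma Ck_on_linear:
  assumes "bounded_linear L" "open S" "Ck_on k S f"
  shows "Ck_on k S (\<lambda>x. L (f x))"
  using assms(3)
proof (induction k arbitrary: f)
  case 0
  then show ?case
    using assms(1) by (simp add: bounded_linear.continuous_on)
next
  case (Suc k)
  show ?case
  proof (rule Ck_on_SucI[OF assms(2)])
    show "((\<lambda>x. L (f x)) has_derivative (\<lambda>v. L (fd f x v))) (at x)" if "x \<in> S" for x
      using bounded_linear.has_derivative[OF assms(1) Ck_on_has_derivative[OF Suc.prems that]] .
    show "Ck_on k S (\<lambda>x. L (fd f x v))" for v
      using Suc by simp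
  qed
qed

lemma Ck_on_add:
  assumes "open S" "Ck_on k S f" "Ck_on k S g"
  shows "Ck_on k S (\<lambda>x. f x + g x)"
  using assms(2,3)
proof (induction k arbitrary: f g)
  case 0
  then show ?case by (simp add: continuous_on_add)
next
  case (Suc k)
  show ?case
  proof (rule Ck_on_SucI[OF assms(1)])
    show "((\<lambda>x. f x + g x) has_derivative (\<lambda>v. fd f x v + fd g x v)) (at x)" if "x \<in> S" for x
      using Ck_on_has_derivative[OF Suc.prems(1) that] Ck_on_has_derivative[OF Suc.prems(2) that]
      by (rule has_derivative_add)
    show "Ck_on k S (\<lambda>x. fd f x v + fd g x v)" for v
      using Suc by simp
  qed
qed

lemma Ck_on_bilinear:
  assumes "bounded_bilinear P" "open S" "Ck_on k S f" "Ck_on k S g"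
  shows "Ck_on k S (\<lambda>x. P (f x) (g x))"
  using assms(3,4)
proof (induction k arbitrary: f g)
  case 0
  then show ?case using assms(1) by (simp add: bounded_bilinear.continuous_on)
next
  case (Suc k)
  show ?case
  proof (rule Ck_on_SucI[OF assms(2)])
    show "((\<lambda>x. P (f x) (g x)) has_derivative (\<lambda>v. P (f x) (fd g x v) + P (fd f x v) (g x))) (at x)"
      if "x \<in> S" for x
      using bounded_bilinear.FDERIV[OF assms(1) Ck_on_has_derivative[OF Suc.prems(1) that]
        Ck_on_has_derivative[OF Suc.prems(2) that]] .
    show "Ck_on k S (\<lambda>x. P (f x) (fd g x v) + P (fd f x v) (g x))" for v
      \<comment> \<open>Each summand of the product rule pairs a derivative, of class k, with an
        undifferentiated factor of class k + 1, which has to be weakened to k.\<close>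
      using Suc.prems Ck_on_SucD[OF Suc.prems(1)] Ck_on_SucD[OF Suc.prems(2)]
      by (intro Ck_on_add Suc.IH assms(2)) auto
  qed
qed

lemma Ck_on_inverse:
  fixes f :: "'a::real_normed_vector \<Rightarrow> real"
  assumes "open S" "\<And>x. x \<in> S \<Longrightarrow> f x \<noteq> 0" "Ck_on k S f"
  shows "Ck_on k S (\<lambda>x. inverse (f x))"
  using assms(3)
proof (induction k)
  case 0
  then show ?case using assms(2) by (simp add: continuous_on_inverse)
next
  case (Suc k)
  show ?case
  proof (rule Ck_on_SucI[OF assms(1)])
    show "((\<lambda>x. inverse (f x)) has_derivative
        (\<lambda>v. - (inverse (f x) * fd f x v * inverse (f x)))) (at x)" if "x \<in> S" for x
      using Deriv.has_derivative_inverse[OF assms(2)[OF that] Ck_on_has_derivative[OF Suc.prems that]] .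
    \<comment> \<open>The derivative of 1/f contains 1/f again, so the induction hypothesis is used
      for the same f.\<close>
    have *: "Ck_on k S (\<lambda>x. inverse (f x))" using Suc Ck_on_SucD by blast
    show "Ck_on k S (\<lambda>x. - (inverse (f x) * fd f x v * inverse (f x)))" for v
      using Suc.prems *
      by (intro Ck_on_linear[OF bounded_linear_minus[OF bounded_linear_ident]]
            Ck_on_bilinear[OF bounded_bilinear_mult] assms(1)) auto
  qed
qed

lemma Ck_on_sum:
  assumes "open S" "\<And>i. i \<in> I \<Longrightarrow> Ck_on k S (f i)"
  shows "Ck_on k S (\<lambda>x. \<Sum>i\<in>I. f i x)"
  using assms(2)
  by (induction I rule: infinite_finite_induct)
    (auto intro: Ck_on_const Ck_on_add[OF assms(1)])

lemma linear_basis_expansion: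
  fixes L :: "'e::euclidean_space \<Rightarrow> 'b::real_vector"
  assumes "linear L"
  shows "L u = (\<Sum>i\<in>Basis. (u \<bullet> i) *\<^sub>R L i)"
proof -
  have "L u = L (\<Sum>i\<in>Basis. (u \<bullet> i) *\<^sub>R i)" by (simp add: euclidean_representation)
  also have "\<dots> = (\<Sum>i\<in>Basis. (u \<bullet> i) *\<^sub>R L i)"
    using assms by (simp add: linear_sum linear_scale)
  finally show ?thesis .
qed

text \<open>The chain rule differentiates f in the direction \<open>fd \<phi> x v\<close>, which
  moves with x. In a basis this becomes a sum of coordinates of \<open>fd \<phi> x v\<close> times
  derivatives of f in fixed directions, composed with \<phi>; the induction hypothesis covers the
  latter.\<close>

lemma Ck_on_compose:
  fixes \<phi> :: "'a::real_normed_vector \<Rightarrow> 'e::euclidean_space"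
  assumes "open S" "\<And>x. x \<in> S \<Longrightarrow> \<phi> x \<in> T" "Ck_on k S \<phi>" "Ck_on k T f"
  shows "Ck_on k S (\<lambda>x. f (\<phi> x))"
  using assms(3,4)
proof (induction k arbitrary: f)
  case 0
  then show ?case using assms(2) by (auto intro: continuous_on_compose2)
next
  case (Suc k)
  show ?case
  proof (rule Ck_on_SucI[OF assms(1)])
    fix x assume x: "x \<in> S"
    have f: "(f has_derivative fd f (\<phi> x)) (at (\<phi> x))"
      using Suc.prems(2) assms(2)[OF x] by (rule Ck_on_has_derivative)
    have *: "((\<lambda>x. f (\<phi> x)) has_derivative (\<lambda>v. fd f (\<phi> x) (fd \<phi> x v))) (at x)"
      using has_derivative_compose[OF Ck_on_has_derivative[OF Suc.prems(1) x] f] .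
    have "fd f (\<phi> x) (fd \<phi> x v) = (\<Sum>i\<in>Basis. (fd \<phi> x v \<bullet> i) *\<^sub>R fd f (\<phi> x) i)" for v
      using f has_derivative_linear by (intro linear_basis_expansion) blast
    with * show "((\<lambda>x. f (\<phi> x)) has_derivative
        (\<lambda>v. \<Sum>i\<in>Basis. (fd \<phi> x v \<bullet> i) *\<^sub>R fd f (\<phi> x) i)) (at x)" by simp
  next
    have "Ck_on k S \<phi>" using Suc.prems(1) by (rule Ck_on_SucD)
    then have "Ck_on k S (\<lambda>x. fd f (\<phi> x) i)" for i
      using Suc.prems(2) Suc.IH[of "\<lambda>y. fd f y i"] by simp
    then show "Ck_on k S (\<lambda>x. \<Sum>i\<in>Basis. (fd \<phi> x v \<bullet> i) *\<^sub>R fd f (\<phi> x) i)" for v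
      using Suc.prems
      by (intro Ck_on_sum Ck_on_bilinear[OF bounded_bilinear_scaleR] assms(1)
          Ck_on_linear[OF bounded_linear_inner_left]) auto
  qed
qed

section \<open>The closure properties for smooth maps, and product rules for families of linear
  maps\<close>

lemma smooth_onD: "smooth_on S f \<Longrightarrow> Ck_on k S f"
  by (simp add: smooth_on_def)

lemma smooth_on_cong:
  "open S \<Longrightarrow> (\<And>x. x \<in> S \<Longrightarrow> f x = g x) \<Longrightarrow> smooth_on S f \<Longrightarrow> smooth_on S g"
  unfolding smooth_on_def using Ck_on_cong by blast

lemma smooth_on_subset: "smooth_on S f \<Longrightarrow> T \<subseteq> S \<Longrightarrow> smooth_on T f"
  unfolding smooth_on_def using Ck_on_subset by blast

lemma smooth_on_const: "smooth_on S (\<lambda>x. c)"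
  unfolding smooth_on_def using Ck_on_const by blast

lemma smooth_on_linear:
  "bounded_linear L \<Longrightarrow> open S \<Longrightarrow> smooth_on S f \<Longrightarrow> smooth_on S (\<lambda>x. L (f x))"
  unfolding smooth_on_def using Ck_on_linear by blast

lemma smooth_on_add:
  "open S \<Longrightarrow> smooth_on S f \<Longrightarrow> smooth_on S g \<Longrightarrow> smooth_on S (\<lambda>x. f x + g x)"
  unfolding smooth_on_def using Ck_on_add by blast

lemma smooth_on_scaleR:
  "open S \<Longrightarrow> smooth_on S f \<Longrightarrow> smooth_on S g \<Longrightarrow> smooth_on S (\<lambda>x. f x *\<^sub>R g x)"
  unfolding smooth_on_def using Ck_on_bilinear[OF bounded_bilinear_scaleR] by blast

lemma smooth_on_mult:
  fixes f g :: "'a::real_normed_vector \<Rightarrow> real"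
  shows "open S \<Longrightarrow> smooth_on S f \<Longrightarrow> smooth_on S g \<Longrightarrow> smooth_on S (\<lambda>x. f x * g x)"
  using smooth_on_scaleR[of S f g] by simp

lemma smooth_on_uminus: "open S \<Longrightarrow> smooth_on S f \<Longrightarrow> smooth_on S (\<lambda>x. - f x)"
  by (rule smooth_on_linear[OF bounded_linear_minus[OF bounded_linear_ident]])

lemma smooth_on_diff:
  "open S \<Longrightarrow> smooth_on S f \<Longrightarrow> smooth_on S g \<Longrightarrow> smooth_on S (\<lambda>x. f x - g x)"
  using smooth_on_add[of S f "\<lambda>x. - g x"] by (simp add: smooth_on_uminus)

lemma smooth_on_inner_left: "open S \<Longrightarrow> smooth_on S f \<Longrightarrow> smooth_on S (\<lambda>x. f x \<bullet> i)"
  by (rule smooth_on_linear[OF bounded_linear_inner_left])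

lemma smooth_on_sum:
  "open S \<Longrightarrow> (\<And>i. i \<in> I \<Longrightarrow> smooth_on S (f i)) \<Longrightarrow> smooth_on S (\<lambda>x. \<Sum>i\<in>I. f i x)"
  unfolding smooth_on_def by (intro allI Ck_on_sum) auto

lemma smooth_on_inverse:
  fixes f :: "'a::real_normed_vector \<Rightarrow> real"
  shows "open S \<Longrightarrow> (\<And>x. x \<in> S \<Longrightarrow> f x \<noteq> 0) \<Longrightarrow> smooth_on S f \<Longrightarrow> smooth_on S (\<lambda>x. inverse (f x))"
  unfolding smooth_on_def using Ck_on_inverse by blast

lemma smooth_on_fd: "smooth_on S f \<Longrightarrow> smooth_on S (\<lambda>x. fd f x v)"
  unfolding smooth_on_def
proof
  show "Ck_on k S (\<lambda>x. fd f x v)" if "\<forall>k. Ck_on k S f" for k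
    using spec[OF that, of "Suc k"] by simp
qed

lemma smooth_on_has_derivative:
  "smooth_on S f \<Longrightarrow> x \<in> S \<Longrightarrow> (f has_derivative fd f x) (at x)"
  unfolding smooth_on_def using Ck_on_has_derivative by blast

lemma smooth_on_linear_fd: "smooth_on S f \<Longrightarrow> x \<in> S \<Longrightarrow> linear (fd f x)"
  using smooth_on_has_derivative has_derivative_linear by blast

lemma smooth_on_continuous: "smooth_on S f \<Longrightarrow> continuous_on S f"
  using smooth_onD[of S f 0] by simp

text \<open>L will be a Jacobian, the components of a 1-form, of its exterior derivative or of the
  metric: smoothness is known for each constant argument, and W is the varying vector
  inserted.\<close>

lemma smooth_on_linear_apply:
  fixes W :: "'a::real_normed_vector \<Rightarrow> 'e::euclidean_space"
  assumes "open S" "\<And>u. smooth_on S (\<lambda>x. L x u)" "\<And>x. x \<in> S \<Longrightarrow> linear (L x)" "smooth_on S W"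
  shows "smooth_on S (\<lambda>x. L x (W x))"
proof (rule smooth_on_cong[OF assms(1)])
  show "(\<Sum>i\<in>Basis. (W x \<bullet> i) *\<^sub>R L x i) = L x (W x)" if "x \<in> S" for x
    by (rule linear_basis_expansion[OF assms(3)[OF that], symmetric])
  show "smooth_on S (\<lambda>x. \<Sum>i\<in>Basis. (W x \<bullet> i) *\<^sub>R L x i)"
    using assms by (intro smooth_on_sum smooth_on_scaleR smooth_on_inner_left)
qed

text \<open>A product rule for evaluation: the first summand freezes the vector at
  \<open>W x\<close> and differentiates only the linear map, the second does the opposite.\<close>

lemma fd_linear_apply:
  fixes W :: "'a::real_normed_vector \<Rightarrow> 'e::euclidean_space"
  assumes "open S" "\<And>u. smooth_on S (\<lambda>x. L x u)" "\<And>x. x \<in> S \<Longrightarrow> linear (L x)" "smooth_on S W"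
    and x: "x \<in> S"
  shows "fd (\<lambda>y. L y (W y)) x v = fd (\<lambda>y. L y (W x)) x v + L x (fd W x v)"
proof -
  have "((\<lambda>y. \<Sum>i\<in>Basis. (W y \<bullet> i) *\<^sub>R L y i) has_derivative
     (\<lambda>v. \<Sum>i\<in>Basis. (W x \<bullet> i) *\<^sub>R fd (\<lambda>y. L y i) x v + (fd W x v \<bullet> i) *\<^sub>R L x i)) (at x)"
    by (intro has_derivative_sum has_derivative_scaleR has_derivative_inner_left
       smooth_on_has_derivative[OF assms(2) x] smooth_on_has_derivative[OF assms(4) x])
  then have "((\<lambda>y. L y (W y)) has_derivative
     (\<lambda>v. \<Sum>i\<in>Basis. (W x \<bullet> i) *\<^sub>R fd (\<lambda>y. L y i) x v + (fd W x v \<bullet> i) *\<^sub>R L x i)) (at x)"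
    by (rule has_derivative_transform_within_open[OF _ assms(1) x])
      (simp add: linear_basis_expansion[OF assms(3), symmetric])
  then have 1: "fd (\<lambda>y. L y (W y)) x v =
      (\<Sum>i\<in>Basis. (W x \<bullet> i) *\<^sub>R fd (\<lambda>y. L y i) x v) + (\<Sum>i\<in>Basis. (fd W x v \<bullet> i) *\<^sub>R L x i)"
    by (simp add: fd_eqI sum.distrib)
  \<comment> \<open>With the coefficients frozen at x, only the first of the two sums survives,
    which identifies it.\<close>
  have "((\<lambda>y. \<Sum>i\<in>Basis. (W x \<bullet> i) *\<^sub>R L y i) has_derivative
     (\<lambda>v. \<Sum>i\<in>Basis. (W x \<bullet> i) *\<^sub>R fd (\<lambda>y. L y i) x v)) (at x)"
    by (intro has_derivative_sum has_derivative_scaleR_right smooth_on_has_derivative[OF assms(2) x])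
  then have "((\<lambda>y. L y (W x)) has_derivative
     (\<lambda>v. \<Sum>i\<in>Basis. (W x \<bullet> i) *\<^sub>R fd (\<lambda>y. L y i) x v)) (at x)"
    by (rule has_derivative_transform_within_open[OF _ assms(1) x])
      (simp add: linear_basis_expansion[OF assms(3), symmetric])
  then have 2: "fd (\<lambda>y. L y (W x)) x v = (\<Sum>i\<in>Basis. (W x \<bullet> i) *\<^sub>R fd (\<lambda>y. L y i) x v)"
    by (simp add: fd_eqI)
  show ?thesis
    unfolding 1 2 linear_basis_expansion[OF assms(3)[OF x], of "fd W x v"] ..
qed

lemma fd_compose_smooth:
  assumes "smooth_on S \<phi>" "smooth_on T f" "x \<in> S" "\<phi> x \<in> T"
  shows "fd (\<lambda>y. f (\<phi> y)) x v = fd f (\<phi> x) (fd \<phi> x v)"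
  using has_derivative_compose[OF smooth_on_has_derivative[OF assms(1,3)]
      smooth_on_has_derivative[OF assms(2,4)]]
  by (simp add: fd_eqI)

lemma smooth_on_compose:
  fixes \<phi> :: "'a::real_normed_vector \<Rightarrow> 'e::euclidean_space"
  shows "open S \<Longrightarrow> (\<And>x. x \<in> S \<Longrightarrow> \<phi> x \<in> T) \<Longrightarrow> smooth_on S \<phi> \<Longrightarrow> smooth_on T f
    \<Longrightarrow> smooth_on S (\<lambda>x. f (\<phi> x))"
  unfolding smooth_on_def using Ck_on_compose by blast

subsection \<open>Symmetry of second derivatives\<close>

text \<open>The mean value theorem is applied twice, first along v and then along w. The left-hand
  side is symmetric in v and w, while the right-hand side is a mixed derivative in a definite
  order.\<close>

lemma second_difference:
  fixes f :: "'e::euclidean_space \<Rightarrow> real"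
  assumes f: "smooth_on S f" and h: "h > 0"
    and sub: "\<And>s t. 0 \<le> s \<Longrightarrow> s \<le> h \<Longrightarrow> 0 \<le> t \<Longrightarrow> t \<le> h \<Longrightarrow> x + s *\<^sub>R v + t *\<^sub>R w \<in> S"
  shows "\<exists>s t. 0 \<le> s \<and> s \<le> h \<and> 0 \<le> t \<and> t \<le> h \<and>
    f (x + h *\<^sub>R v + h *\<^sub>R w) - f (x + h *\<^sub>R v) - f (x + h *\<^sub>R w) + f x
     = h * h * fd (\<lambda>y. fd f y v) (x + s *\<^sub>R v + t *\<^sub>R w) w"
proof -
  have line: "((\<lambda>r. F (a + r *\<^sub>R u)) has_real_derivative fd F (a + r *\<^sub>R u) u) (at r)"
    if "smooth_on S F" "a + r *\<^sub>R u \<in> S" for F :: "'e \<Rightarrow> real" and a r u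
  proof -
    have "((\<lambda>r. F (a + r *\<^sub>R u)) has_derivative (\<lambda>k. fd F (a + r *\<^sub>R u) (k *\<^sub>R u))) (at r)"
      by (rule has_derivative_compose[where g = F and f = "\<lambda>r. a + r *\<^sub>R u",
            OF _ smooth_on_has_derivative[OF that]])
        (auto intro!: derivative_eq_intros)
    moreover have "fd F (a + r *\<^sub>R u) (k *\<^sub>R u) = fd F (a + r *\<^sub>R u) u * k" for k
      using linear_scale[OF smooth_on_linear_fd[OF that]] by (simp add: mult.commute)
    ultimately show ?thesis
      by (simp add: has_field_derivative_def)
  qed
  \<comment> \<open>\<open>\<psi>\<close> is the increment of f along w as a function of the
    position along v, so its own increment over the interval from 0 to h is the second
    difference.\<close>
  define \<psi> where "\<psi> = (\<lambda>s. f ((x + h *\<^sub>R w) + s *\<^sub>R v) - f (x + s *\<^sub>R v))"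
  have "(\<psi> has_real_derivative (fd f ((x + h *\<^sub>R w) + s *\<^sub>R v) v - fd f (x + s *\<^sub>R v) v)) (at s)"
    if "0 \<le> s" "s \<le> h" for s
    unfolding \<psi>_def using sub[of s h] sub[of s 0] that h
    by (intro DERIV_diff line f) (auto simp: algebra_simps)
  from MVT2[OF h this] obtain s where s: "0 < s" "s < h"
    and 1: "\<psi> h - \<psi> 0 = h * (fd f ((x + h *\<^sub>R w) + s *\<^sub>R v) v - fd f (x + s *\<^sub>R v) v)" by auto
  have "((\<lambda>t. fd f ((x + s *\<^sub>R v) + t *\<^sub>R w) v) has_real_derivative
      fd (\<lambda>y. fd f y v) ((x + s *\<^sub>R v) + t *\<^sub>R w) w) (at t)" if "0 \<le> t" "t \<le> h" for t
    using sub[of s t] that s by (intro line smooth_on_fd f) auto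
  from MVT2[OF h this] obtain t where t: "0 < t" "t < h"
    and 2: "fd f ((x + s *\<^sub>R v) + h *\<^sub>R w) v - fd f (x + s *\<^sub>R v) v
      = h * fd (\<lambda>y. fd f y v) ((x + s *\<^sub>R v) + t *\<^sub>R w) w" by auto
  have "f (x + h *\<^sub>R v + h *\<^sub>R w) - f (x + h *\<^sub>R v) - f (x + h *\<^sub>R w) + f x = \<psi> h - \<psi> 0"
    by (simp add: \<psi>_def algebra_simps)
  also have "\<dots> = h * h * fd (\<lambda>y. fd f y v) (x + s *\<^sub>R v + t *\<^sub>R w) w"
    using 1 2 by (simp add: algebra_simps)
  finally show ?thesis using s t by (intro exI[of _ s] exI[of _ t]) auto
qed

text \<open>The same second difference yields both mixed derivatives, each at some point of a small
  parallelogram at x. Continuity of the two mixed derivatives carries the equality over to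
  x.\<close>

lemma fd_fd_commute_real:
  fixes f :: "'e::euclidean_space \<Rightarrow> real"
  assumes "open S" and f: "smooth_on S f" and x: "x \<in> S"
  shows "fd (\<lambda>y. fd f y v) x w = fd (\<lambda>y. fd f y w) x v"
proof -
  define F where "F = (\<lambda>y. fd (\<lambda>y. fd f y v) y w)"
  define G where "G = (\<lambda>y. fd (\<lambda>y. fd f y w) y v)"
  have cont: "isCont F x" "isCont G x"
    using smooth_on_continuous[OF smooth_on_fd[OF smooth_on_fd[OF f]]] x assms(1)
    unfolding F_def G_def by (simp_all add: continuous_on_eq_continuous_at)
  have "\<bar>F x - G x\<bar> \<le> e" if e: "e > 0" for e
  proof -
    obtain d1 where d1: "d1 > 0" "\<And>y. dist y x < d1 \<Longrightarrow> dist (F y) (F x) < e/2"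
      using cont(1) e unfolding continuous_at_eps_delta by (meson half_gt_zero)
    obtain d2 where d2: "d2 > 0" "\<And>y. dist y x < d2 \<Longrightarrow> dist (G y) (G x) < e/2"
      using cont(2) e unfolding continuous_at_eps_delta by (meson half_gt_zero)
    obtain d3 where d3: "d3 > 0" "\<And>y. dist y x < d3 \<Longrightarrow> y \<in> S"
      using assms(1) x unfolding open_dist by blast
    define d where "d = min d1 (min d2 d3)"
    \<comment> \<open>The parallelogram reaches no farther than h (norm v + norm w) from x. The
      summand 1 keeps the quotient meaningful when v and w vanish and makes the bound
      strict.\<close>
    define h where "h = d / (2 * (norm v + norm w + 1))"
    have d: "d > 0" using d1 d2 d3 by (simp add: d_def)
    then have h: "h > 0" unfolding h_def by (intro divide_pos_pos) (auto simp: add_nonneg_pos)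
    have near: "dist (x + s *\<^sub>R v + t *\<^sub>R w) x < d" if "0 \<le> s" "s \<le> h" "0 \<le> t" "t \<le> h" for s t
    proof -
      have "dist (x + s *\<^sub>R v + t *\<^sub>R w) x \<le> norm (s *\<^sub>R v) + norm (t *\<^sub>R w)"
        by (metis add.assoc add_diff_cancel_left' dist_norm norm_triangle_ineq)
      also have "\<dots> \<le> h * norm v + h * norm w"
        using that by (auto intro!: add_mono mult_right_mono)
      also have "\<dots> < h * (2 * (norm v + norm w + 1))"
        using h by (simp add: distrib_left add_nonneg_pos add.assoc)
      also have "\<dots> = d"
      proof -
        have "0 < 2 * (norm v + norm w + 1)"
          by (intro mult_pos_pos add_nonneg_pos add_nonneg_nonneg) auto
        then have "2 * (norm v + norm w + 1) \<noteq> 0" by (metis less_irrefl)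
        from nonzero_divide_eq_eq[OF this, THEN iffD1, OF h_def[symmetric]] show ?thesis by simp
      qed
      finally show ?thesis .
    qed
    obtain s t where st: "0 \<le> s" "s \<le> h" "0 \<le> t" "t \<le> h" and
      1: "f (x + h *\<^sub>R v + h *\<^sub>R w) - f (x + h *\<^sub>R v) - f (x + h *\<^sub>R w) + f x
         = h * h * F (x + s *\<^sub>R v + t *\<^sub>R w)"
      using second_difference[OF f h, of x v w] near d3 unfolding F_def d_def by (smt (verit))
    have near': "dist (x + s *\<^sub>R w + t *\<^sub>R v) x < d" if "0 \<le> s" "s \<le> h" "0 \<le> t" "t \<le> h" for s t
      using near[of t s] that by (simp add: algebra_simps)
    obtain s' t' where st': "0 \<le> s'" "s' \<le> h" "0 \<le> t'" "t' \<le> h" and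
      2: "f (x + h *\<^sub>R w + h *\<^sub>R v) - f (x + h *\<^sub>R w) - f (x + h *\<^sub>R v) + f x
         = h * h * G (x + s' *\<^sub>R w + t' *\<^sub>R v)"
      using second_difference[OF f h, of x w v] near' d3 unfolding G_def d_def by (smt (verit))
    have "h * h * F (x + s *\<^sub>R v + t *\<^sub>R w) = h * h * G (x + s' *\<^sub>R w + t' *\<^sub>R v)"
      using 1 2 by (simp add: algebra_simps)
    then have "F (x + s *\<^sub>R v + t *\<^sub>R w) = G (x + s' *\<^sub>R w + t' *\<^sub>R v)" using h by simp
    moreover have "dist (F (x + s *\<^sub>R v + t *\<^sub>R w)) (F x) < e/2"
      using near[OF st] by (intro d1) (simp add: d_def)
    moreover have "dist (G (x + s' *\<^sub>R w + t' *\<^sub>R v)) (G x) < e/2"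
      using near'[OF st'] by (intro d2) (simp add: d_def)
    ultimately show ?thesis unfolding dist_real_def by (smt (verit) field_sum_of_halves)
  qed
  then have "\<bar>F x - G x\<bar> \<le> 0" by (rule field_le_epsilon) simp
  then show ?thesis by (simp add: F_def G_def)
qed

lemma fd_fd_commute:
  fixes f :: "'e::euclidean_space \<Rightarrow> 'f::euclidean_space"
  assumes S: "open S" and f: "smooth_on S f" and x: "x \<in> S"
  shows "fd (\<lambda>y. fd f y v) x w = fd (\<lambda>y. fd f y w) x v"
\<comment> \<open>Taking the inner product with a fixed b commutes with differentiation, so the real
  case applies to each component.\<close>
proof (rule euclidean_eqI)
  fix b :: 'f
  have inner: "fd (\<lambda>y. F y \<bullet> b) z u = fd F z u \<bullet> b" if "smooth_on S F" "z \<in> S" for F :: "'e \<Rightarrow> 'f" and z u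
    by (rule fun_cong[OF fd_eqI]) (intro has_derivative_inner_left smooth_on_has_derivative[OF that])
  have "fd (\<lambda>y. fd (\<lambda>y. f y \<bullet> b) y v) x w = fd (\<lambda>y. fd f y v \<bullet> b) x w" for v w
    using fd_cong_open[OF S x, of "\<lambda>y. fd (\<lambda>y. f y \<bullet> b) y v" "\<lambda>y. fd f y v \<bullet> b"] inner[OF f] by simp
  then have "fd (\<lambda>y. fd (\<lambda>y. f y \<bullet> b) y v) x w = fd (\<lambda>y. fd f y v) x w \<bullet> b" for v w
    using inner[OF smooth_on_fd[OF f] x] by simp
  then show "fd (\<lambda>y. fd f y v) x w \<bullet> b = fd (\<lambda>y. fd f y w) x v \<bullet> b"
    using fd_fd_commute_real[OF S smooth_on_inner_left[OF S f] x] by metis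
qed


subsection \<open>Smooth solution of positive definite linear systems\<close>

text \<open>By induction over the basis vectors tested against: if \<open>P\<close> is the orthogonal projection of a
  new basis vector \<open>b\<close> to the span of the previous ones, then adding a multiple of \<open>b - P\<close> fixes
  the value on \<open>b\<close> without disturbing the earlier ones.\<close>

lemma smooth_gram_solve:
  fixes G :: "'e::euclidean_space \<Rightarrow> 'e \<Rightarrow> 'e \<Rightarrow> real"
  assumes S: "open S"
    and smG: "\<And>u w. smooth_on S (\<lambda>x. G x u w)"
    and linG: "\<And>x u. x \<in> S \<Longrightarrow> linear (G x u)"
    and symG: "\<And>x u w. x \<in> S \<Longrightarrow> G x u w = G x w u"
    and posG: "\<And>x u. x \<in> S \<Longrightarrow> u \<noteq> 0 \<Longrightarrow> G x u u > 0"
    and sm\<beta>: "\<And>u. smooth_on S (\<lambda>x. \<beta> x u)"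
    and lin\<beta>: "\<And>x. x \<in> S \<Longrightarrow> linear (\<beta> x)"
  obtains W where "smooth_on S W" "\<And>x u. x \<in> S \<Longrightarrow> G x (W x) u = \<beta> x u"
proof -
  have linG': "linear (\<lambda>u. G x u w)" if "x \<in> S" for x w
    using linG[OF that, of w] symG[OF that] by (simp add: linear_iff)
  have smGW: "smooth_on S (\<lambda>x. G x (W x) w)" if "smooth_on S W" for W w
    using smooth_on_linear_apply[OF S smG linG' that] .
  \<comment> \<open>The right-hand side \<beta> is generalised because the induction hypothesis is
    used twice, the second time for the functional \<open>G x b\<close>, whose solution is the
    projection. The clause \<open>W x \<in> span I\<close> is needed for that projection. Only
    values on basis vectors are tracked; linearity extends them at the end.\<close>
  have "\<exists>W. smooth_on S W \<and> (\<forall>x\<in>S. W x \<in> span I \<and> (\<forall>s\<in>I. G x (W x) s = \<beta> x s))"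
    if "finite I" "I \<subseteq> Basis" "\<And>u. smooth_on S (\<lambda>x. \<beta> x u)" for I and \<beta> :: "'e \<Rightarrow> 'e \<Rightarrow> real"
    using that
  proof (induction I arbitrary: \<beta> rule: finite_induct)
    case empty
    show ?case by (intro exI[of _ "\<lambda>x. 0"]) (simp add: smooth_on_const)
  next
    case (insert b I)
    from insert.IH[of "\<lambda>x u. G x b u"] insert.prems smG
    obtain P where P: "smooth_on S P" "\<And>x. x \<in> S \<Longrightarrow> P x \<in> span I"
      "\<And>x s. x \<in> S \<Longrightarrow> s \<in> I \<Longrightarrow> G x (P x) s = G x b s" by auto
    from insert.IH[of \<beta>] insert.prems
    obtain W where W: "smooth_on S W" "\<And>x. x \<in> S \<Longrightarrow> W x \<in> span I"
      "\<And>x s. x \<in> S \<Longrightarrow> s \<in> I \<Longrightarrow> G x (W x) s = \<beta> x s" by auto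
    define E where "E = (\<lambda>x. b - P x)"
    have E: "smooth_on S E" unfolding E_def by (intro smooth_on_diff smooth_on_const S P)
    have b: "b \<notin> span I"
    proof -
      have "independent (insert b I)" using insert.prems(1) independent_Basis independent_mono by blast
      then show ?thesis using insert.hyps(2) by (simp add: independent_insert)
    qed
    have E0: "G x (E x) s = 0" if "x \<in> S" "s \<in> I" for x s
      using P(3)[OF that] linear_diff[OF linG'[OF that(1)]] by (simp add: E_def)
    \<comment> \<open>As E is orthogonal to P, \<open>G x (E x) b\<close> equals
      \<open>G x (E x) (E x)\<close>; this is positive because b is outside the span of I. It is the
      only quantity divided by.\<close>
    have Epos: "G x (E x) b > 0" if x: "x \<in> S" for x
    proof -
      have "E x \<noteq> 0" using b P(2)[OF x] by (auto simp: E_def)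
      then have "0 < G x (E x) (b - P x)" using posG[OF x] by (simp add: E_def)
      also have "\<dots> = G x (E x) b - G x (E x) (P x)" using linear_diff[OF linG[OF x]] .
      also have "G x (E x) (P x) = 0"
        using linear_eq_0_on_span[OF linG[OF x] E0[OF x] P(2)[OF x]] .
      finally show ?thesis by simp
    qed
    \<comment> \<open>The coefficient of E is the remaining error at b divided by the value of E at
      b.\<close>
    define W' where "W' = (\<lambda>x. W x + ((\<beta> x b - G x (W x) b) * inverse (G x (E x) b)) *\<^sub>R E x)"
    have "smooth_on S W'"
      unfolding W'_def using Epos
      by (intro smooth_on_add smooth_on_scaleR smooth_on_mult smooth_on_inverse smooth_on_diff
          S W E smGW insert.prems) (simp add: less_imp_neq[symmetric])
    moreover have "W' x \<in> span (insert b I)" if x: "x \<in> S" for x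
    proof -
      have "span I \<subseteq> span (insert b I)" by (rule span_mono) auto
      then have "W x \<in> span (insert b I)" "P x \<in> span (insert b I)" "b \<in> span (insert b I)"
        using W(2)[OF x] P(2)[OF x] by (auto intro: span_base)
      then show ?thesis unfolding W'_def E_def by (intro span_add span_scale span_diff)
    qed
    moreover have "G x (W' x) s = \<beta> x s" if x: "x \<in> S" and s: "s \<in> insert b I" for x s
    proof -
      have "G x (W' x) s = G x (W x) s + (\<beta> x b - G x (W x) b) * inverse (G x (E x) b) * G x (E x) s"
        using linear_add[OF linG'[OF x]] linear_scale[OF linG'[OF x]] by (simp add: W'_def)
      moreover have "inverse (G x (E x) b) * G x (E x) b = 1" using Epos[OF x] by simp
      ultimately show ?thesis using s E0[OF x] W(3)[OF x] by (auto simp: mult.assoc)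
    qed
    ultimately show ?case by blast
  qed
  from this[of Basis \<beta>, OF finite_Basis subset_refl sm\<beta>]
  obtain W where W: "smooth_on S W" "\<And>x s. x \<in> S \<Longrightarrow> s \<in> Basis \<Longrightarrow> G x (W x) s = \<beta> x s" by blast
  show thesis
  proof (rule that[OF W(1)])
    show "G x (W x) u = \<beta> x u" if x: "x \<in> S" for x u
      using linear_eq_stdbasis[OF linG[OF x] lin\<beta>[OF x] W(2)[OF x]] by (rule fun_cong)
  qed
qed

subsection \<open>Charts and tangent spaces\<close>

locale atlas_manifold =
  fixes M :: "'m topology" and A :: "('m, 'e::euclidean_space) atlas"
  assumes manifold: "smooth_manifold M A"
begin

abbreviation overlap :: "('m, 'e) chart \<Rightarrow> ('m, 'e) chart \<Rightarrow> 'e set" where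
  "overlap c c' \<equiv> chart_map c ` (chart_dom c \<inter> chart_dom c')"

abbreviation jac :: "('m, 'e) chart \<Rightarrow> ('m, 'e) chart \<Rightarrow> 'm \<Rightarrow> 'e \<Rightarrow> 'e" where
  "jac c c' p \<equiv> fd (transition c c') (chart_map c p)"

lemma charts_atD: "c \<in> charts_at A p \<Longrightarrow> c \<in> A" "c \<in> charts_at A p \<Longrightarrow> p \<in> chart_dom c"
  by (simp_all add: charts_at_def)

lemma charts_at_points: "p \<in> points A \<longleftrightarrow> charts_at A p \<noteq> {}"
  unfolding charts_at_def by blast

lemma some_chart_in: "c \<in> charts_at A p \<Longrightarrow> some_chart A p \<in> charts_at A p"
  unfolding some_chart_def by (rule someI)

lemma is_chart: "c \<in> A \<Longrightarrow> is_chart M c"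
  using manifold by (simp add: smooth_manifold_def)

lemma open_range: "c \<in> A \<Longrightarrow> open (chart_range c)"
  using is_chart by (simp add: is_chart_def)

lemma chart_inj: "c \<in> A \<Longrightarrow> inj_on (chart_map c) (chart_dom c)"
  using is_chart[of c] openin_subset[of M "chart_dom c"]
  by (auto simp: is_chart_def homeomorphic_map_def dest!: homeomorphic_imp_injective_map
      simp: topspace_subtopology Int_absorb1)

lemma chart_inv_map [simp]: "c \<in> A \<Longrightarrow> p \<in> chart_dom c \<Longrightarrow> chart_inv c (chart_map c p) = p"
  using chart_inj by (rule inv_into_f_f)

lemma chart_inv_in: "x \<in> chart_range c \<Longrightarrow> chart_inv c x \<in> chart_dom c"
  by (rule inv_into_into)

lemma chart_map_inv: "x \<in> chart_range c \<Longrightarrow> chart_map c (chart_inv c x) = x"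
  by (rule f_inv_into_f)

lemma chart_inv_charts_at: "c \<in> A \<Longrightarrow> x \<in> chart_range c \<Longrightarrow> c \<in> charts_at A (chart_inv c x)"
  by (simp add: charts_at_def chart_inv_in)

text \<open>A chart map is open onto its range, and the range is open in the model space. All
  derivatives of transitions are taken on these sets.\<close>

lemma open_overlap:
  assumes "c \<in> A" "c' \<in> A"
  shows "open (overlap c c')"
proof -
  have "openin M (chart_dom c \<inter> chart_dom c')"
    using is_chart[OF assms(1)] is_chart[OF assms(2)] by (auto simp: is_chart_def)
  then have "openin (subtopology M (chart_dom c)) (chart_dom c \<inter> chart_dom c')"
    by (metis Int_commute inf_left_idem openin_subtopology)
  moreover have "open_map (subtopology M (chart_dom c)) (top_of_set (chart_range c)) (chart_map c)"
    using is_chart[OF assms(1)] homeomorphic_imp_open_map by (auto simp: is_chart_def)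
  ultimately have "openin (top_of_set (chart_range c)) (overlap c c')"
    by (simp add: open_map_def)
  then show ?thesis
    using openin_open_trans open_range[OF assms(1)] by blast
qed

lemma overlap_subset: "overlap c c' \<subseteq> chart_range c"
  by auto

lemma overlap_charts_at:
  assumes "c \<in> A" "c' \<in> A" "x \<in> overlap c c'"
  shows "c \<in> charts_at A (chart_inv c x)" "c' \<in> charts_at A (chart_inv c x)"
  using assms by (auto simp: charts_at_def)

lemma charts_at_overlap:
  "c \<in> charts_at A p \<Longrightarrow> c' \<in> charts_at A p \<Longrightarrow> chart_map c p \<in> overlap c c'"
  by (auto simp: charts_at_def)

lemma transition_map [simp]:
  "c \<in> charts_at A p \<Longrightarrow> transition c c' (chart_map c p) = chart_map c' p"
  by (simp add: charts_at_def)

lemma transition_in: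
  assumes "c \<in> A" "c' \<in> A" "x \<in> overlap c c'"
  shows "transition c c' x \<in> chart_range c'" "chart_inv c' (transition c c' x) = chart_inv c x"
  using assms by auto

lemma transition_smooth: "c \<in> A \<Longrightarrow> c' \<in> A \<Longrightarrow> smooth_on (overlap c c') (transition c c')"
  using manifold by (simp add: smooth_manifold_def)

lemma linear_jac:
  assumes "c \<in> charts_at A p" "c' \<in> charts_at A p"
  shows "linear (jac c c' p)"
  using smooth_on_linear_fd[OF transition_smooth charts_at_overlap[OF assms]] assms charts_atD
  by blast

lemma jac_self [simp]:
  assumes "c \<in> charts_at A p"
  shows "jac c c p u = u"
proof -
  have "fd (transition c c) (chart_map c p) = fd (\<lambda>x. x) (chart_map c p)"
    using charts_at_overlap[OF assms assms] charts_atD[OF assms]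
    by (intro fd_cong_open[OF open_overlap[of c c]]) auto
  then show ?thesis by simp
qed

lemma jac_trans:
  assumes c: "c \<in> charts_at A p" "c' \<in> charts_at A p" "c'' \<in> charts_at A p"
  shows "jac c' c'' p (jac c c' p u) = jac c c'' p u"
proof -
  note A = charts_atD(1)[OF c(1)] charts_atD(1)[OF c(2)] charts_atD(1)[OF c(3)]
  \<comment> \<open>The cocycle identity for transitions holds only at points common to all three
    charts; by injectivity of c these have image \<open>?U\<close>.\<close>
  let ?U = "overlap c c' \<inter> overlap c c''"
  have "transition c' c'' (transition c c' x) = transition c c'' x" if "x \<in> ?U" for x
    using overlap_charts_at[OF A(1,2)] overlap_charts_at[OF A(1,3)] that A by (simp add: charts_at_def)
  then have "fd (\<lambda>x. transition c' c'' (transition c c' x)) (chart_map c p) = jac c c'' p"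
    using charts_at_overlap c A
    by (intro fd_cong_open[of ?U] open_Int open_overlap) auto
  moreover have "fd (\<lambda>x. transition c' c'' (transition c c' x)) (chart_map c p) u
      = fd (transition c' c'') (transition c c' (chart_map c p)) (jac c c' p u)"
    using c by (intro fd_compose_smooth[OF transition_smooth[OF A(1,2)] transition_smooth[OF A(2,3)]]
        charts_at_overlap) (simp_all only: transition_map charts_at_overlap)
  ultimately show ?thesis using A charts_atD(2)[OF c(1)] by simp
qed

lemma tangentD:
  "v \<in> tangent_space A p \<Longrightarrow> c \<in> charts_at A p \<Longrightarrow> c' \<in> charts_at A p \<Longrightarrow> v c' = jac c c' p (v c)"
  "v \<in> tangent_space A p \<Longrightarrow> c \<notin> charts_at A p \<Longrightarrow> v c = 0"
  unfolding tangent_space_def by blast+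

lemma tangentI:
  assumes "\<And>c. c \<notin> charts_at A p \<Longrightarrow> v c = 0"
    "\<And>c c'. c \<in> charts_at A p \<Longrightarrow> c' \<in> charts_at A p \<Longrightarrow> v c' = jac c c' p (v c)"
  shows "v \<in> tangent_space A p"
  using assms unfolding tangent_space_def by blast

lemma coord_vec_tangent: "c \<in> charts_at A p \<Longrightarrow> coord_vec A c p u \<in> tangent_space A p"
  by (rule tangentI) (simp_all add: coord_vec_def jac_trans)

lemma coord_vec_self [simp]: "c \<in> charts_at A p \<Longrightarrow> coord_vec A c p u c = u"
  by (simp add: coord_vec_def)

text \<open>A tangent vector is determined by a single component. This lets all later arguments work
  in one chart at a time.\<close>

lemma coord_vec_component:
  assumes "c \<in> charts_at A p" "v \<in> tangent_space A p"
  shows "coord_vec A c p (v c) = v"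
proof
  show "coord_vec A c p (v c) c' = v c'" for c'
    using tangentD(2)[OF assms(2), of c'] tangentD(1)[OF assms(2,1), of c'] by (simp add: coord_vec_def)
qed

lemma coord_vec_change:
  "c \<in> charts_at A p \<Longrightarrow> c' \<in> charts_at A p \<Longrightarrow> coord_vec A c p u = coord_vec A c' p (jac c c' p u)"
  by (rule ext) (simp add: coord_vec_def jac_trans)

lemma coord_vec_add:
  assumes "c \<in> charts_at A p"
  shows "coord_vec A c p (u + w) = coord_vec A c p u + coord_vec A c p w"
  using linear_jac[OF assms] by (auto simp: coord_vec_def linear_add)

lemma coord_vec_scale:
  assumes "c \<in> charts_at A p"
  shows "coord_vec A c p (r *\<^sub>R u) = tscale r (coord_vec A c p u)"
  using linear_jac[OF assms] by (auto simp: coord_vec_def tscale_def linear_scale)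

lemma tangent_zero: "0 \<in> tangent_space A p"
  by (rule tangentI) (auto simp: linear_0[OF linear_jac])

lemma tangent_add:
  assumes v: "v \<in> tangent_space A p" and w: "w \<in> tangent_space A p"
  shows "v + w \<in> tangent_space A p"
proof (rule tangentI)
  show "(v + w) c' = jac c c' p ((v + w) c)" if c: "c \<in> charts_at A p" "c' \<in> charts_at A p" for c c'
    using tangentD(1)[OF v c] tangentD(1)[OF w c] linear_add[OF linear_jac[OF c]] by simp
qed (simp add: tangentD(2)[OF v] tangentD(2)[OF w])

lemma tangent_scale:
  assumes v: "v \<in> tangent_space A p"
  shows "tscale r v \<in> tangent_space A p"
proof (rule tangentI)
  show "tscale r v c' = jac c c' p (tscale r v c)"
    if c: "c \<in> charts_at A p" "c' \<in> charts_at A p" for c c'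
    using tangentD(1)[OF v c] linear_scale[OF linear_jac[OF c]] by (simp add: tscale_def)
qed (simp add: tscale_def tangentD(2)[OF v])

lemma tangent_off_points: "p \<notin> points A \<Longrightarrow> v \<in> tangent_space A p \<Longrightarrow> v = 0"
  using tangentD(2) charts_at_points by fastforce

subsection \<open>Local representatives of vector fields and forms\<close>

text \<open>\<open>vrep\<close> and \<open>frep\<close> move fields and forms to an open set of the
  model space, where Frechet derivatives are available.\<close>

definition vrep :: "('m, 'e) chart \<Rightarrow> ('m, 'e) vfield \<Rightarrow> 'e \<Rightarrow> 'e" where
  "vrep c X x = X (chart_inv c x) c"

definition frep :: "('m, 'e) chart \<Rightarrow> ('m, 'e) form \<Rightarrow> 'e \<Rightarrow> 'e \<Rightarrow> real" where
  "frep c \<alpha> x u = \<alpha> (chart_inv c x) (coord_vec A c (chart_inv c x) u)"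

lemma vector_fieldsD:
  "X \<in> vector_fields A \<Longrightarrow> X p \<in> tangent_space A p"
  "X \<in> vector_fields A \<Longrightarrow> c \<in> A \<Longrightarrow> smooth_on (chart_range c) (vrep c X)"
  by (auto simp: vector_fields_def vrep_def[abs_def])

lemma vector_fieldsI:
  "(\<And>p. X p \<in> tangent_space A p) \<Longrightarrow> (\<And>c. c \<in> A \<Longrightarrow> smooth_on (chart_range c) (vrep c X))
   \<Longrightarrow> X \<in> vector_fields A"
  by (auto simp: vector_fields_def vrep_def[abs_def])

lemma vrep_map: "c \<in> charts_at A p \<Longrightarrow> vrep c X (chart_map c p) = X p c"
  by (simp add: vrep_def charts_at_def)

lemma frep_map:
  "c \<in> charts_at A p \<Longrightarrow> v \<in> tangent_space A p \<Longrightarrow> frep c \<alpha> (chart_map c p) (v c) = \<alpha> p v"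
  using charts_atD[of c p] by (simp add: frep_def coord_vec_component)

lemma vrep_transition:
  assumes "X \<in> vector_fields A" "c \<in> A" "c' \<in> A" "x \<in> overlap c c'"
  shows "vrep c' X (transition c c' x) = fd (transition c c') x (vrep c X x)"
  using tangentD(1)[OF vector_fieldsD(1)[OF assms(1)] overlap_charts_at[OF assms(2-4)]] assms(4)
    transition_in(2)[OF assms(2-4)] chart_map_inv[of x c]
  by (auto simp: vrep_def)

text \<open>The pullback law for covectors: the coordinate vectors of u in c and of its Jacobian
  image in c' are the same tangent vector.\<close>

lemma frep_transition:
  assumes "c \<in> A" "c' \<in> A" "x \<in> overlap c c'"
  shows "frep c' \<alpha> (transition c c' x) (fd (transition c c') x u) = frep c \<alpha> x u"
  using coord_vec_change[OF overlap_charts_at[OF assms], of u] transition_in(2)[OF assms]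
    chart_map_inv[of x c] assms(3) overlap_subset
  by (auto simp: frep_def)

lemma one_formsD:
  assumes "\<alpha> \<in> one_forms A"
  shows "restrict_form A \<alpha> = \<alpha>"
    and "p \<in> points A \<Longrightarrow> v \<in> tangent_space A p \<Longrightarrow> w \<in> tangent_space A p \<Longrightarrow> \<alpha> p (v + w) = \<alpha> p v + \<alpha> p w"
    and "p \<in> points A \<Longrightarrow> v \<in> tangent_space A p \<Longrightarrow> \<alpha> p (tscale r v) = r * \<alpha> p v"
    and "c \<in> A \<Longrightarrow> smooth_on (chart_range c) (\<lambda>x. frep c \<alpha> x u)"
  using assms by (auto simp: one_forms_def frep_def)

lemma linear_frep:
  assumes "\<alpha> \<in> one_forms A" "c \<in> A" "x \<in> chart_range c"
  shows "linear (frep c \<alpha> x)"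
proof -
  note c = chart_inv_charts_at[OF assms(2,3)]
  then have p: "chart_inv c x \<in> points A" using charts_at_points by auto
  show ?thesis
    using one_formsD(2,3)[OF assms(1) p] coord_vec_tangent[OF c]
    by (auto simp: frep_def coord_vec_add[OF c] coord_vec_scale[OF c] intro!: linearI)
qed

lemma one_form_eq_0: "\<alpha> \<in> one_forms A \<Longrightarrow> p \<notin> points A \<or> v \<notin> tangent_space A p \<Longrightarrow> \<alpha> p v = 0"
  using one_formsD(1) by (metis restrict_form_def)

lemma one_formsI:
  assumes "\<And>p v. p \<notin> points A \<or> v \<notin> tangent_space A p \<Longrightarrow> \<alpha> p v = 0"
    and lin: "\<And>c x. c \<in> A \<Longrightarrow> x \<in> chart_range c \<Longrightarrow> linear (frep c \<alpha> x)"
    and "\<And>c u. c \<in> A \<Longrightarrow> smooth_on (chart_range c) (\<lambda>x. frep c \<alpha> x u)"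
  shows "\<alpha> \<in> one_forms A"
proof -
  have "\<alpha> p (v + w) = \<alpha> p v + \<alpha> p w \<and> \<alpha> p (tscale r v) = r * \<alpha> p v"
    if "p \<in> points A" and v: "v \<in> tangent_space A p" and w: "w \<in> tangent_space A p" for p v w r
  proof -
    obtain c where c: "c \<in> charts_at A p" using \<open>p \<in> points A\<close> charts_at_points by blast
    have lin': "linear (frep c \<alpha> (chart_map c p))" using lin charts_atD[OF c] by blast
    show ?thesis
      using frep_map[OF c v, of \<alpha>] frep_map[OF c w, of \<alpha>] frep_map[OF c tangent_add[OF v w], of \<alpha>]
        frep_map[OF c tangent_scale[OF v, of r], of \<alpha>] linear_add[OF lin'] linear_scale[OF lin']
      by (simp add: tscale_def)
  qed
  moreover have "restrict_form A \<alpha> = \<alpha>" using assms(1) by (fastforce simp: restrict_form_def)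
  ultimately show ?thesis using assms(3) unfolding one_forms_def frep_def by blast
qed

lemma vector_field_add:
  assumes "X \<in> vector_fields A" "Y \<in> vector_fields A"
  shows "X + Y \<in> vector_fields A"
proof (rule vector_fieldsI)
  show "(X + Y) p \<in> tangent_space A p" for p
    using assms by (simp add: tangent_add vector_fieldsD)
  show "smooth_on (chart_range c) (vrep c (X + Y))" if "c \<in> A" for c
    using smooth_on_add[OF open_range[OF that] vector_fieldsD(2)[OF assms(1) that]
        vector_fieldsD(2)[OF assms(2) that]]
    by (simp add: vrep_def[abs_def])
qed

lemma vector_field_scale:
  assumes "X \<in> vector_fields A"
  shows "fun_scale (\<lambda>p. r) X \<in> vector_fields A"
proof (rule vector_fieldsI)
  show "fun_scale (\<lambda>p. r) X p \<in> tangent_space A p" for p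
    using assms by (simp add: fun_scale_def tangent_scale vector_fieldsD)
  show "smooth_on (chart_range c) (vrep c (fun_scale (\<lambda>p. r) X))" if "c \<in> A" for c
    using smooth_on_scaleR[OF open_range[OF that] smooth_on_const vector_fieldsD(2)[OF assms that]]
    by (simp add: vrep_def[abs_def] fun_scale_def tscale_def)
qed

lemma vector_field_diff:
  assumes "X \<in> vector_fields A" "Y \<in> vector_fields A"
  shows "X - Y \<in> vector_fields A"
proof -
  have eq: "X - Y = X + fun_scale (\<lambda>p. -1) Y"
    by (rule ext)+ (simp add: fun_scale_def tscale_def)
  show ?thesis unfolding eq using assms by (intro vector_field_add vector_field_scale)
qed

subsection \<open>Lie bracket and exterior derivative\<close>

lemma lie_bracket_rep:
  assumes "c \<in> A" "x \<in> chart_range c"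
  shows "vrep c (lie_bracket A X Y) x = fd (vrep c Y) x (vrep c X x) - fd (vrep c X) x (vrep c Y x)"
  using chart_inv_charts_at[OF assms] chart_map_inv[OF assms(2)]
  by (simp add: vrep_def[abs_def] lie_bracket_def)

text \<open>This differentiates the transformation law of X. The first summand, a second derivative
  of the transition, is the obstruction to the derivative of a field being a tensor.\<close>

lemma fd_vrep_transition:
  assumes X: "X \<in> vector_fields A" and c: "c \<in> A" "c' \<in> A" and x: "x \<in> overlap c c'"
  shows "fd (vrep c' X) (transition c c' x) (fd (transition c c') x a)
    = fd (\<lambda>y. fd (transition c c') y (vrep c X x)) x a + fd (transition c c') x (fd (vrep c X) x a)"
proof -
  note S = open_overlap[OF c] and sm = transition_smooth[OF c]
  have "fd (vrep c' X) (transition c c' x) (fd (transition c c') x a)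
      = fd (\<lambda>y. vrep c' X (transition c c' y)) x a"
    by (rule fd_compose_smooth[OF sm vector_fieldsD(2)[OF X c(2)] x transition_in(1)[OF c x], symmetric])
  also have "\<dots> = fd (\<lambda>y. fd (transition c c') y (vrep c X y)) x a"
    by (rule fun_cong[OF fd_cong_open[OF S x]]) (simp only: vrep_transition[OF X c])
  also have "\<dots> = fd (\<lambda>y. fd (transition c c') y (vrep c X x)) x a
      + fd (transition c c') x (fd (vrep c X) x a)"
    by (rule fd_linear_apply[OF S smooth_on_fd[OF sm] smooth_on_linear_fd[OF sm]
          smooth_on_subset[OF vector_fieldsD(2)[OF X c(1)] overlap_subset] x])
  finally show ?thesis .
qed

lemma lie_bracket_vector_field:
  assumes X: "X \<in> vector_fields A" and Y: "Y \<in> vector_fields A"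
  shows "lie_bracket A X Y \<in> vector_fields A"
proof (rule vector_fieldsI)
  show "lie_bracket A X Y p \<in> tangent_space A p" for p
  proof (rule tangentI)
    show "lie_bracket A X Y p c = 0" if "c \<notin> charts_at A p" for c
      using that by (simp add: lie_bracket_def)
    show "lie_bracket A X Y p c' = jac c c' p (lie_bracket A X Y p c)"
      if c: "c \<in> charts_at A p" "c' \<in> charts_at A p" for c c'
    proof -
      note cA = charts_atD(1)[OF c(1)] charts_atD(1)[OF c(2)]
      let ?x = "chart_map c p" and ?\<phi> = "transition c c'"
      have x: "?x \<in> overlap c c'" using charts_at_overlap[OF c] .
      have x': "?x \<in> chart_range c" "?\<phi> ?x \<in> chart_range c'" using x transition_in[OF cA x] by auto
      have "lie_bracket A X Y p c' = vrep c' (lie_bracket A X Y) (?\<phi> ?x)"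
        using c by (simp add: vrep_map del: comp_apply)
      also have "\<dots> = fd (vrep c' Y) (?\<phi> ?x) (fd ?\<phi> ?x (vrep c X ?x))
          - fd (vrep c' X) (?\<phi> ?x) (fd ?\<phi> ?x (vrep c Y ?x))"
        using lie_bracket_rep[OF cA(2) x'(2)] vrep_transition[OF X cA x] vrep_transition[OF Y cA x]
        by simp
      also have "\<dots> = fd ?\<phi> ?x (fd (vrep c Y) ?x (vrep c X ?x)) - fd ?\<phi> ?x (fd (vrep c X) ?x (vrep c Y ?x))"
        unfolding fd_vrep_transition[OF X cA x] fd_vrep_transition[OF Y cA x]
        \<comment> \<open>The two second-derivative terms differ only in the order of the directions
          X and Y, so they cancel in the difference.\<close>
        using fd_fd_commute[OF open_overlap[OF cA] transition_smooth[OF cA] x, of "vrep c X ?x" "vrep c Y ?x"]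
        by simp
      also have "\<dots> = jac c c' p (vrep c (lie_bracket A X Y) ?x)"
        unfolding lie_bracket_rep[OF cA(1) x'(1)] linear_diff[OF linear_jac[OF c]] ..
      also have "vrep c (lie_bracket A X Y) ?x = lie_bracket A X Y p c" using vrep_map[OF c(1)] .
      finally show ?thesis .
    qed
  qed
  show "smooth_on (chart_range c) (vrep c (lie_bracket A X Y))" if c: "c \<in> A" for c
  proof (rule smooth_on_cong[OF open_range[OF c] lie_bracket_rep[OF c, symmetric]])
    note S = open_range[OF c] and sm = vector_fieldsD(2)[OF X c] vector_fieldsD(2)[OF Y c]
    show "smooth_on (chart_range c) (\<lambda>x. fd (vrep c Y) x (vrep c X x) - fd (vrep c X) x (vrep c Y x))"
      using smooth_on_linear_apply[OF S smooth_on_fd[OF sm(2)] smooth_on_linear_fd[OF sm(2)] sm(1)]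
        smooth_on_linear_apply[OF S smooth_on_fd[OF sm(1)] smooth_on_linear_fd[OF sm(1)] sm(2)]
      by (rule smooth_on_diff[OF S])
  qed
qed

section \<open>Pairings and differentials of functions\<close>

lemma pairing_smooth:
  assumes "\<mu> \<in> one_forms A" "X \<in> vector_fields A"
  shows "pairing \<mu> X \<in> smooth_functions A"
proof -
  have "smooth_on (chart_range c) (pairing \<mu> X \<circ> chart_inv c)" if c: "c \<in> A" for c
  proof (rule smooth_on_cong[OF open_range[OF c]])
    show "frep c \<mu> x (vrep c X x) = (pairing \<mu> X \<circ> chart_inv c) x" if "x \<in> chart_range c" for x
      using coord_vec_component[OF chart_inv_charts_at[OF c that] vector_fieldsD(1)[OF assms(2)]]
      by (simp add: frep_def vrep_def pairing_def)
    show "smooth_on (chart_range c) (\<lambda>x. frep c \<mu> x (vrep c X x))"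
      by (rule smooth_on_linear_apply[OF open_range[OF c] one_formsD(4)[OF assms(1) c]
            linear_frep[OF assms(1) c] vector_fieldsD(2)[OF assms(2) c]])
  qed
  then show ?thesis by (simp add: smooth_functions_def)
qed

lemma smooth_function_diff:
  assumes "f \<in> smooth_functions A" "h \<in> smooth_functions A"
  shows "f - h \<in> smooth_functions A"
  using assms smooth_on_diff[OF open_range] by (fastforce simp: smooth_functions_def comp_def)

text \<open>The chain rule for the transition removes the dependence on
  \<open>some_chart\<close>.\<close>

lemma differential_chart:
  assumes f: "f \<in> smooth_functions A" and c: "c \<in> charts_at A p" and v: "v \<in> tangent_space A p"
  shows "differential A f p v = fd (f \<circ> chart_inv c) (chart_map c p) (v c)"
proof -
  define c' where "c' = some_chart A p"
  have c': "c' \<in> charts_at A p" using some_chart_in[OF c] by (simp add: c'_def)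
  note cA = charts_atD(1)[OF c] charts_atD(1)[OF c']
  have x: "chart_map c p \<in> overlap c c'" using charts_at_overlap[OF c c'] .
  have "p \<in> points A" using c charts_at_points by auto
  then have "differential A f p v = fd (f \<circ> chart_inv c') (chart_map c' p) (jac c c' p (v c))"
    using v tangentD(1)[OF v c c'] by (simp add: differential_def restrict_form_def Let_def c'_def)
  also have "\<dots> = fd (\<lambda>y. (f \<circ> chart_inv c') (transition c c' y)) (chart_map c p) (v c)"
    using fd_compose_smooth[OF transition_smooth[OF cA], of "chart_range c'" "f \<circ> chart_inv c'"]
      f cA x transition_in(1)[OF cA x] transition_map[OF c] by (simp add: smooth_functions_def)
  also have "\<dots> = fd (f \<circ> chart_inv c) (chart_map c p) (v c)"
    using fd_cong_open[OF open_overlap[OF cA] x, of "\<lambda>y. (f \<circ> chart_inv c') (transition c c' y)"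
        "f \<circ> chart_inv c"] transition_in(2)[OF cA] by simp
  finally show ?thesis .
qed

lemma frep_differential:
  assumes "f \<in> smooth_functions A" "c \<in> A" "x \<in> chart_range c"
  shows "frep c (differential A f) x u = fd (f \<circ> chart_inv c) x u"
  using differential_chart[OF assms(1) chart_inv_charts_at[OF assms(2,3)] coord_vec_tangent]
    chart_inv_charts_at[OF assms(2,3)] chart_map_inv[OF assms(3)]
  by (simp add: frep_def)

lemma differential_one_form:
  assumes "f \<in> smooth_functions A"
  shows "differential A f \<in> one_forms A"
proof (rule one_formsI)
  show "differential A f p v = 0" if "p \<notin> points A \<or> v \<notin> tangent_space A p" for p v
    using that by (auto simp: differential_def restrict_form_def)
  fix c assume c: "c \<in> A"
  have f: "smooth_on (chart_range c) (f \<circ> chart_inv c)" using assms c by (simp add: smooth_functions_def)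
  show "linear (frep c (differential A f) x)" if "x \<in> chart_range c" for x
    using smooth_on_linear_fd[OF f that] frep_differential[OF assms c that] by presburger
  show "smooth_on (chart_range c) (\<lambda>x. frep c (differential A f) x u)" for u
    by (rule smooth_on_cong[OF open_range[OF c] frep_differential[OF assms c, symmetric] smooth_on_fd[OF f]])
qed

section \<open>Exterior derivatives and the bracket of forms\<close>

definition drep :: "('m, 'e) chart \<Rightarrow> ('m, 'e) form \<Rightarrow> 'e \<Rightarrow> 'e \<Rightarrow> 'e \<Rightarrow> real" where
  "drep c \<mu> x a b = fd (\<lambda>y. frep c \<mu> y b) x a - fd (\<lambda>y. frep c \<mu> y a) x b"

text \<open>\<open>drep\<close> is d\<mu> on the constant fields a and b of a chart, which commute,
  so no bracket term occurs. Constant fields do not stay constant under a change of chart; the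
  correction is \<mu> applied to a second derivative of the transition, symmetric in a and
  b.\<close>

lemma drep_transition:
  assumes \<mu>: "\<mu> \<in> one_forms A" and c: "c \<in> A" "c' \<in> A" and x: "x \<in> overlap c c'"
  shows "drep c' \<mu> (transition c c' x) (fd (transition c c') x a) (fd (transition c c') x b)
    = drep c \<mu> x a b"
proof -
  let ?\<phi> = "transition c c'"
  note S = open_overlap[OF c] and sm = transition_smooth[OF c]
  have sm': "smooth_on (overlap c c') (\<lambda>y. frep c' \<mu> (?\<phi> y) u)" for u
    using smooth_on_compose[OF S transition_in(1)[OF c] sm one_formsD(4)[OF \<mu> c(2)]] .
  have *: "fd (\<lambda>y. frep c \<mu> y b) x a = fd (\<lambda>y. frep c' \<mu> y (fd ?\<phi> x b)) (?\<phi> x) (fd ?\<phi> x a)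
      + frep c' \<mu> (?\<phi> x) (fd (\<lambda>y. fd ?\<phi> y b) x a)" for a b
  proof -
    have "fd (\<lambda>y. frep c \<mu> y b) x a = fd (\<lambda>y. frep c' \<mu> (?\<phi> y) (fd ?\<phi> y b)) x a"
      by (rule fun_cong[OF fd_cong_open[OF S x]]) (simp only: frep_transition[OF c])
    also have "\<dots> = fd (\<lambda>y. frep c' \<mu> (?\<phi> y) (fd ?\<phi> x b)) x a
        + frep c' \<mu> (?\<phi> x) (fd (\<lambda>y. fd ?\<phi> y b) x a)"
      by (rule fd_linear_apply[OF S sm' linear_frep[OF \<mu> c(2) transition_in(1)[OF c]]
            smooth_on_fd[OF sm] x])
    also have "fd (\<lambda>y. frep c' \<mu> (?\<phi> y) (fd ?\<phi> x b)) x a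
        = fd (\<lambda>y. frep c' \<mu> y (fd ?\<phi> x b)) (?\<phi> x) (fd ?\<phi> x a)"
      by (rule fd_compose_smooth[OF sm one_formsD(4)[OF \<mu> c(2)] x transition_in(1)[OF c x]])
    finally show ?thesis .
  qed
  show ?thesis
    unfolding drep_def *[of a b] *[of b a] fd_fd_commute[OF S sm x, of a b] by simp
qed

lemma ext_deriv_chart:
  assumes \<mu>: "\<mu> \<in> one_forms A" and c: "c \<in> charts_at A p"
    and v: "v \<in> tangent_space A p" and w: "w \<in> tangent_space A p"
  shows "ext_deriv A \<mu> p v w = drep c \<mu> (chart_map c p) (v c) (w c)"
proof -
  define c' where "c' = some_chart A p"
  have c': "c' \<in> charts_at A p" using some_chart_in[OF c] by (simp add: c'_def)
  note cA = charts_atD(1)[OF c] charts_atD(1)[OF c']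
  have "ext_deriv A \<mu> p v w = drep c' \<mu> (chart_map c' p) (v c') (w c')"
    by (simp add: ext_deriv_def Let_def drep_def frep_def c'_def)
  also have "\<dots> = drep c \<mu> (chart_map c p) (v c) (w c)"
    using drep_transition[OF \<mu> cA charts_at_overlap[OF c c'], of "v c" "w c"] transition_map[OF c]
      tangentD(1)[OF v c c'] tangentD(1)[OF w c c'] by simp
  finally show ?thesis .
qed

text \<open>In each of the two terms one argument is a direction of differentiation, where linearity
  is that of the derivative. The other is an argument of the form, and there linearity holds at
  every point near x and passes through the derivative.\<close>

lemma linear_drep:
  assumes \<mu>: "\<mu> \<in> one_forms A" and c: "c \<in> A" and x: "x \<in> chart_range c"
  shows "linear (drep c \<mu> x a)" "linear (\<lambda>a. drep c \<mu> x a b)"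
proof -
  have 1: "linear (\<lambda>a. fd (\<lambda>y. frep c \<mu> y b) x a)" for b
    using smooth_on_linear_fd[OF one_formsD(4)[OF \<mu> c] x] .
  have 2: "linear (\<lambda>b. fd (\<lambda>y. frep c \<mu> y b) x a)" for a
  proof (rule linearI)
    have hd: "((\<lambda>y. frep c \<mu> y b) has_derivative fd (\<lambda>y. frep c \<mu> y b) x) (at x)" for b
      using smooth_on_has_derivative[OF one_formsD(4)[OF \<mu> c] x] .
    fix b b' r
    have "fd (\<lambda>y. frep c \<mu> y (b + b')) x = fd (\<lambda>y. frep c \<mu> y b + frep c \<mu> y b') x"
      using linear_add[OF linear_frep[OF \<mu> c]] by (intro fd_cong_open[OF open_range[OF c] x])
    then show "fd (\<lambda>y. frep c \<mu> y (b + b')) x a = fd (\<lambda>y. frep c \<mu> y b) x a + fd (\<lambda>y. frep c \<mu> y b') x a"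
      using fd_eqI[OF has_derivative_add[OF hd[of b] hd[of b']]] by simp
    have "fd (\<lambda>y. frep c \<mu> y (r *\<^sub>R b)) x = fd (\<lambda>y. r *\<^sub>R frep c \<mu> y b) x"
      using linear_scale[OF linear_frep[OF \<mu> c]] by (intro fd_cong_open[OF open_range[OF c] x])
    then show "fd (\<lambda>y. frep c \<mu> y (r *\<^sub>R b)) x a = r *\<^sub>R fd (\<lambda>y. frep c \<mu> y b) x a"
      using fd_eqI[OF has_derivative_scaleR_right[OF hd[of b]]] by simp
  qed
  show "linear (drep c \<mu> x a)" "linear (\<lambda>a. drep c \<mu> x a b)"
    using linear_compose_sub[OF 2 1] linear_compose_sub[OF 1 2] by (simp_all add: drep_def[abs_def])
qed

lemma frep_contract:
  assumes \<mu>: "\<mu> \<in> one_forms A" and X: "X \<in> vector_fields A" and c: "c \<in> A" and x: "x \<in> chart_range c"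
  shows "frep c (contract_ext_deriv A X \<mu>) x u = drep c \<mu> x (vrep c X x) u"
proof -
  note cp = chart_inv_charts_at[OF c x]
  then have "chart_inv c x \<in> points A" using charts_at_points by auto
  then show ?thesis
    using ext_deriv_chart[OF \<mu> cp vector_fieldsD(1)[OF X] coord_vec_tangent[OF cp, of u]]
      coord_vec_tangent[OF cp, of u] chart_map_inv[OF x] cp
    by (simp add: frep_def contract_ext_deriv_def restrict_form_def vrep_def)
qed

lemma contract_one_form:
  assumes \<mu>: "\<mu> \<in> one_forms A" and X: "X \<in> vector_fields A"
  shows "contract_ext_deriv A X \<mu> \<in> one_forms A"
proof (rule one_formsI)
  show "contract_ext_deriv A X \<mu> p v = 0" if "p \<notin> points A \<or> v \<notin> tangent_space A p" for p v
    using that by (auto simp: contract_ext_deriv_def restrict_form_def)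
  fix c assume c: "c \<in> A"
  note S = open_range[OF c]
  show "linear (frep c (contract_ext_deriv A X \<mu>) x)" if "x \<in> chart_range c" for x
    using linear_drep(1)[OF \<mu> c that] frep_contract[OF \<mu> X c that] by presburger
  show "smooth_on (chart_range c) (\<lambda>x. frep c (contract_ext_deriv A X \<mu>) x u)" for u
  proof (rule smooth_on_cong[OF S frep_contract[OF \<mu> X c, symmetric]])
    have "smooth_on (chart_range c) (\<lambda>x. drep c \<mu> x a u)" for a
      unfolding drep_def by (intro smooth_on_diff S smooth_on_fd one_formsD(4)[OF \<mu> c])
    then show "smooth_on (chart_range c) (\<lambda>x. drep c \<mu> x (vrep c X x) u)"
      by (rule smooth_on_linear_apply[OF S, of "\<lambda>x a. drep c \<mu> x a u", OF _
            linear_drep(2)[OF \<mu> c] vector_fieldsD(2)[OF X c]])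
  qed
qed

text \<open>The scalar r serves for the coefficients -1 and 1/2 of the bracket.\<close>

lemma one_form_add_scale:
  assumes "\<alpha> \<in> one_forms A" "\<beta> \<in> one_forms A"
  shows "(\<lambda>p v. \<alpha> p v + r * \<beta> p v) \<in> one_forms A"
proof (rule one_formsI)
  show "\<alpha> p v + r * \<beta> p v = 0" if "p \<notin> points A \<or> v \<notin> tangent_space A p" for p v
    using one_form_eq_0[OF assms(1) that] one_form_eq_0[OF assms(2) that] by simp
  fix c assume c: "c \<in> A"
  have rep: "frep c (\<lambda>p v. \<alpha> p v + r * \<beta> p v) = (\<lambda>x u. frep c \<alpha> x u + r *\<^sub>R frep c \<beta> x u)"
    by (simp add: frep_def[abs_def])
  show "linear (frep c (\<lambda>p v. \<alpha> p v + r * \<beta> p v) x)" if "x \<in> chart_range c" for x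
    unfolding rep using linear_frep[OF _ c that] assms
    by (intro linear_compose_add linear_compose_scale_right) auto
  show "smooth_on (chart_range c) (\<lambda>x. frep c (\<lambda>p v. \<alpha> p v + r * \<beta> p v) x u)" for u
    unfolding rep using one_formsD(4)[OF _ c] assms
    by (intro smooth_on_add smooth_on_scaleR smooth_on_const open_range c) auto
qed

lemma form_bracket_one_form:
  assumes "X \<in> vector_fields A" "Y \<in> vector_fields A" "\<omega> \<in> one_forms A" "\<mu> \<in> one_forms A"
  shows "form_bracket A (X, \<omega>) (Y, \<mu>) \<in> one_forms A"
proof -
  define f where "f = pairing \<mu> X - pairing \<omega> Y"
  have f: "differential A f \<in> one_forms A"
    unfolding f_def by (intro differential_one_form smooth_function_diff pairing_smooth assms)
  have "form_bracket A (X, \<omega>) (Y, \<mu>) = (\<lambda>p v. (contract_ext_deriv A X \<mu> p v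
      + (-1) * contract_ext_deriv A Y \<omega> p v) + 1/2 * differential A f p v)"
    by (rule ext)+ (simp add: form_bracket_def f_def)
  moreover have "\<dots> \<in> one_forms A"
    by (intro one_form_add_scale contract_one_form assms f)
  ultimately show ?thesis by simp
qed

end

subsection \<open>The metric identifies vector fields with 1-forms\<close>

locale riemannian_atlas_manifold = atlas_manifold M A
  for M :: "'m topology" and A :: "('m, 'e::euclidean_space) atlas" +
  fixes g :: "('m, 'e) metric"
  assumes metric: "riemannian_metric A g"
begin

lemma metricD:
  assumes "p \<in> points A" "u \<in> tangent_space A p" "v \<in> tangent_space A p"
  shows "g p u v = g p v u"
    and "w \<in> tangent_space A p \<Longrightarrow> g p (u + v) w = g p u w + g p v w"
    and "g p (tscale r u) v = r * g p u v"
    and "u \<noteq> 0 \<Longrightarrow> g p u u > 0"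
  using metric assms unfolding riemannian_metric_def by blast+

text \<open>The Gram form of the metric in a chart, as fed to
  \<open>smooth_gram_solve\<close>.\<close>

definition metric_rep :: "('m, 'e) chart \<Rightarrow> 'e \<Rightarrow> 'e \<Rightarrow> 'e \<Rightarrow> real" where
  "metric_rep c x u w = g (chart_inv c x) (coord_vec A c (chart_inv c x) u) (coord_vec A c (chart_inv c x) w)"

lemma smooth_metric_rep: "c \<in> A \<Longrightarrow> smooth_on (chart_range c) (\<lambda>x. metric_rep c x u w)"
  using metric by (simp add: riemannian_metric_def metric_rep_def)

lemma metric_rep_inner:
  assumes c: "c \<in> A" and x: "x \<in> chart_range c"
  shows "metric_rep c x u w = metric_rep c x w u" "linear (metric_rep c x u)" "linear (\<lambda>u. metric_rep c x u w)"
    "u \<noteq> 0 \<Longrightarrow> metric_rep c x u u > 0"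
proof -
  note cp = chart_inv_charts_at[OF c x]
  then have p: "chart_inv c x \<in> points A" using charts_at_points by blast
  note t = coord_vec_tangent[OF cp]
  show sym: "metric_rep c x u w = metric_rep c x w u" for u w
    unfolding metric_rep_def by (rule metricD(1)[OF p t t])
  show lin: "linear (\<lambda>u. metric_rep c x u w)" for w
    using metricD(2,3)[OF p t t] t by (intro linearI) (simp_all add: metric_rep_def coord_vec_add[OF cp] coord_vec_scale[OF cp])
  have "metric_rep c x u = (\<lambda>w. metric_rep c x w u)" using sym by blast
  then show "linear (metric_rep c x u)" using lin by simp
  show "metric_rep c x u u > 0" if "u \<noteq> 0"
  proof -
    have "coord_vec A c (chart_inv c x) u \<noteq> 0"
      using coord_vec_self[OF cp, of u] that by (metis zero_fun_apply)
    then show ?thesis unfolding metric_rep_def by (rule metricD(4)[OF p t t])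
  qed
qed

lemma frep_flat:
  assumes X: "X \<in> vector_fields A" and c: "c \<in> A" and x: "x \<in> chart_range c"
  shows "frep c (flat A g X) x u = metric_rep c x (vrep c X x) u"
proof -
  note cp = chart_inv_charts_at[OF c x]
  then have p: "chart_inv c x \<in> points A" using charts_at_points by blast
  show ?thesis
    using p coord_vec_tangent[OF cp] coord_vec_component[OF cp vector_fieldsD(1)[OF X]]
    by (simp add: frep_def flat_def restrict_form_def metric_rep_def vrep_def)
qed

lemma flat_one_form:
  assumes X: "X \<in> vector_fields A"
  shows "flat A g X \<in> one_forms A"
proof (rule one_formsI)
  show "flat A g X p v = 0" if "p \<notin> points A \<or> v \<notin> tangent_space A p" for p v
    using that by (auto simp: flat_def restrict_form_def)
  fix c assume c: "c \<in> A"
  show "linear (frep c (flat A g X) x)" if x: "x \<in> chart_range c" for x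
    using metric_rep_inner(2)[OF c x, of "vrep c X x"] frep_flat[OF X c x] by presburger
  show "smooth_on (chart_range c) (\<lambda>x. frep c (flat A g X) x u)" for u
  proof (rule smooth_on_cong[OF open_range[OF c] frep_flat[OF X c, symmetric]])
    show "smooth_on (chart_range c) (\<lambda>x. metric_rep c x (vrep c X x) u)"
      by (rule smooth_on_linear_apply[OF open_range[OF c], of "\<lambda>x w. metric_rep c x w u",
            OF smooth_metric_rep[OF c] metric_rep_inner(3)[OF c] vector_fieldsD(2)[OF X c]])
  qed
qed

lemma metric_inj:
  assumes p: "p \<in> points A" and v: "v \<in> tangent_space A p" and w: "w \<in> tangent_space A p"
    and eq: "\<And>u. u \<in> tangent_space A p \<Longrightarrow> g p v u = g p w u"
  shows "v = w"
proof (rule ccontr)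
  assume "v \<noteq> w"
  \<comment> \<open>The metric is tested on the difference of v and w, written with
    \<open>tscale\<close> because bilinearity is available for sums and \<open>tscale\<close>
    only.\<close>
  have w': "tscale (-1) w \<in> tangent_space A p" using w by (rule tangent_scale)
  have d: "v + tscale (-1) w \<in> tangent_space A p" using v w' by (rule tangent_add)
  have "v + tscale (-1) w \<noteq> 0" using \<open>v \<noteq> w\<close> by (auto simp: tscale_def fun_eq_iff)
  then have "0 < g p (v + tscale (-1) w) (v + tscale (-1) w)" by (rule metricD(4)[OF p d d])
  also have "\<dots> = g p v (v + tscale (-1) w) - g p w (v + tscale (-1) w)"
    using metricD(2)[OF p v w' d] metricD(3)[OF p w d, of "-1"] by simp
  also have "\<dots> = 0" using eq[OF d] by simp
  finally show False by simp
qed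

lemma flat_eq_iff:
  assumes X: "X \<in> vector_fields A" and Y: "Y \<in> vector_fields A"
  shows "flat A g X = flat A g Y \<longleftrightarrow> X = Y"
proof
  assume eq: "flat A g X = flat A g Y"
  show "X = Y"
  proof
    fix p
    note t = vector_fieldsD(1)[OF X, of p] vector_fieldsD(1)[OF Y, of p]
    show "X p = Y p"
    proof (cases "p \<in> points A")
      case True
      show ?thesis
      proof (rule metric_inj[OF True t])
        show "g p (X p) u = g p (Y p) u" if "u \<in> tangent_space A p" for u
          using fun_cong[OF fun_cong[OF eq, of p], of u] True that by (simp add: flat_def restrict_form_def)
      qed
    next
      case False
      then show ?thesis using tangent_off_points t by metis
    qed
  qed
qed simp

text \<open>The system is solved in each chart separately. Positive definiteness makes the local
  solutions unique, so they agree as tangent vectors on overlaps and patch together without a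
  partition of unity.\<close>

lemma flat_surj:
  assumes \<alpha>: "\<alpha> \<in> one_forms A"
  obtains X where "X \<in> vector_fields A" "flat A g X = \<alpha>"
proof -
  have "\<exists>W. smooth_on (chart_range c) W \<and> (\<forall>x\<in>chart_range c. \<forall>u. metric_rep c x (W x) u = frep c \<alpha> x u)"
    if c: "c \<in> A" for c
    using smooth_gram_solve[OF open_range[OF c] smooth_metric_rep[OF c] metric_rep_inner(2,1,4)[OF c]
        one_formsD(4)[OF \<alpha> c] linear_frep[OF \<alpha> c]] by metis
  then obtain W where W: "\<And>c. c \<in> A \<Longrightarrow> smooth_on (chart_range c) (W c)"
    "\<And>c x u. c \<in> A \<Longrightarrow> x \<in> chart_range c \<Longrightarrow> metric_rep c x (W c x) u = frep c \<alpha> x u" by metis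
  have dual: "g p (coord_vec A c p (W c (chart_map c p))) v = \<alpha> p v"
    if c: "c \<in> charts_at A p" and v: "v \<in> tangent_space A p" for c p v
  proof -
    have "chart_map c p \<in> chart_range c" using charts_atD[OF c] by simp
    then have "metric_rep c (chart_map c p) (W c (chart_map c p)) (v c) = frep c \<alpha> (chart_map c p) (v c)"
      by (rule W(2)[OF charts_atD(1)[OF c]])
    then show ?thesis
      using frep_map[OF c v] charts_atD[OF c] coord_vec_component[OF c v] by (simp add: metric_rep_def)
  qed
  \<comment> \<open>At points outside all charts the tangent space is zero, which forces the default
    value.\<close>
  define X where "X = (\<lambda>p. if p \<in> points A
    then coord_vec A (some_chart A p) p (W (some_chart A p) (chart_map (some_chart A p) p)) else 0)"
  \<comment> \<open>Independence of the chosen chart: smoothness in c can then be read off from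
    \<open>W c\<close>.\<close>
  have X: "X p = coord_vec A c p (W c (chart_map c p))" if c: "c \<in> charts_at A p" for c p
  proof -
    have p: "p \<in> points A" using c charts_at_points by blast
    note c' = some_chart_in[OF c]
    have "coord_vec A (some_chart A p) p (W (some_chart A p) (chart_map (some_chart A p) p))
        = coord_vec A c p (W c (chart_map c p))"
      by (rule metric_inj[OF p coord_vec_tangent[OF c'] coord_vec_tangent[OF c]])
        (simp only: dual[OF c] dual[OF c'])
    then show ?thesis using p by (simp only: X_def if_True)
  qed
  have XA: "X \<in> vector_fields A"
  proof (rule vector_fieldsI)
    show "X p \<in> tangent_space A p" for p
    proof (cases "charts_at A p = {}")
      case True
      then have "p \<notin> points A" using charts_at_points by blast
      then show ?thesis by (simp only: X_def if_False tangent_zero)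
    next
      case False
      then obtain c where "c \<in> charts_at A p" by blast
      then show ?thesis using X coord_vec_tangent by metis
    qed
    show "smooth_on (chart_range c) (vrep c X)" if c: "c \<in> A" for c
    proof (rule smooth_on_cong[OF open_range[OF c] _ W(1)[OF c]])
      show "W c x = vrep c X x" if x: "x \<in> chart_range c" for x
        using X[OF chart_inv_charts_at[OF c x]] coord_vec_self[OF chart_inv_charts_at[OF c x]]
        by (simp add: vrep_def chart_map_inv[OF x])
    qed
  qed
  have "flat A g X p v = \<alpha> p v" for p v
  proof (cases "p \<in> points A \<and> v \<in> tangent_space A p")
    case True
    then obtain c where "c \<in> charts_at A p" using charts_at_points by blast
    then show ?thesis using True dual X by (simp add: flat_def restrict_form_def)
  next
    case False
    then show ?thesis using one_form_eq_0[OF \<alpha>, of p v] by (auto simp: flat_def restrict_form_def)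
  qed
  then have "flat A g X = \<alpha>" by blast
  with XA show thesis by (rule that)
qed

lemma sharp_flat: "X \<in> vector_fields A \<Longrightarrow> sharp A g (flat A g X) = X"
  unfolding sharp_def by (rule the_equality) (auto simp: flat_eq_iff)

lemma flat_add:
  assumes "X \<in> vector_fields A" "Y \<in> vector_fields A"
  shows "flat A g (X + Y) = flat A g X + flat A g Y"
  using metricD(2)[OF _ vector_fieldsD(1)[OF assms(1)] vector_fieldsD(1)[OF assms(2)]]
  by (auto simp: flat_def restrict_form_def fun_eq_iff)

lemma flat_diff:
  assumes "X \<in> vector_fields A" "Y \<in> vector_fields A"
  shows "flat A g (X - Y) = flat A g X - flat A g Y"
  using flat_add[OF vector_field_diff[OF assms] assms(2)] by (simp add: algebra_simps)

subsection \<open>Membership in the Dirac structure\<close>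

lemma module_automorphism_closed:
  "module_automorphism A B \<Longrightarrow> X \<in> vector_fields A \<Longrightarrow> B X \<in> vector_fields A"
  unfolding module_automorphism_def by (blast dest: bij_betwE)

lemma form_action_flat:
  "X \<in> vector_fields A \<Longrightarrow> form_action A g B (flat A g X) = flat A g (B X)"
  by (simp add: form_action_def sharp_flat)

lemma module_automorphism_cayley:
  assumes B: "module_automorphism A B" and Z: "Z \<in> vector_fields A" and W: "W \<in> vector_fields A"
  shows "(\<exists>X\<in>vector_fields A. Z = X + B X \<and> W = X - B X) \<longleftrightarrow> W + B W = Z - B Z"
proof -
  note BV = module_automorphism_closed[OF B]
  have Badd: "B (X + Y) = B X + B Y" if "X \<in> vector_fields A" "Y \<in> vector_fields A" for X Y
    using B that by (simp add: module_automorphism_def)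
  have Bdiff: "B (X - Y) = B X - B Y" if "X \<in> vector_fields A" "Y \<in> vector_fields A" for X Y
    using Badd[OF vector_field_diff[OF that] that(2)] by (simp add: algebra_simps)
  show ?thesis
  proof
    assume "\<exists>X\<in>vector_fields A. Z = X + B X \<and> W = X - B X"
    \<comment> \<open>Both sides expand to X - B (B X).\<close>
    then show "W + B W = Z - B Z" using BV by (auto simp: Badd Bdiff)
  next
    assume eq: "W + B W = Z - B Z"
    define X where "X = fun_scale (\<lambda>p. 1/2) (Z + W)"
    have ZW: "Z + W \<in> vector_fields A" using Z W by (rule vector_field_add)
    then have X: "X \<in> vector_fields A" unfolding X_def by (rule vector_field_scale)
    have half: "fun_scale (\<lambda>p. 1/2) (V + V) = V" for V :: "('m, 'e) vfield"
      by (rule ext)+ (simp add: fun_scale_def tscale_def flip: scaleR_add_left)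
    \<comment> \<open>Halving commutes with B as multiplication by a constant smooth
      function.\<close>
    have "(\<lambda>p. 1/2) \<in> smooth_functions A"
      by (simp add: smooth_functions_def comp_def smooth_on_const)
    then have BX: "B X = fun_scale (\<lambda>p. 1/2) (B Z + B W)"
      using B ZW Badd[OF Z W] by (simp add: X_def module_automorphism_def)
    have scale: "fun_scale (\<lambda>p. 1/2) U + fun_scale (\<lambda>p. 1/2) V = fun_scale (\<lambda>p. 1/2) (U + V)"
      "fun_scale (\<lambda>p. 1/2) U - fun_scale (\<lambda>p. 1/2) V = fun_scale (\<lambda>p. 1/2) (U - V)"
      for U V :: "('m, 'e) vfield"
      by ((rule ext)+, simp add: fun_scale_def tscale_def algebra_simps)+
    \<comment> \<open>The assumed equation says B Z + B W = Z - W, so 2X + 2BX and 2X - 2BX become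
      2Z and 2W.\<close>
    have sums: "Z + W + (B Z + B W) = Z + Z" "Z + W - (B Z + B W) = W + W"
      using eq by (simp_all add: algebra_simps)
    have "X + B X = Z" unfolding BX unfolding X_def scale sums half ..
    moreover have "X - B X = W" unfolding BX unfolding X_def scale sums half ..
    ultimately show "\<exists>X\<in>vector_fields A. Z = X + B X \<and> W = X - B X" using X by metis
  qed
qed

lemma dirac_structure_form:
  assumes "module_automorphism A B" "X \<in> vector_fields A"
  shows "flat A g X - form_action A g B (flat A g X) = flat A g (X - B X)"
  using assms by (simp add: form_action_flat flat_diff module_automorphism_closed)

text \<open>The pairwise form of the equivalence. Surjectivity of \<open>flat\<close> replaces
  \<beta> by a field W, and injectivity with additivity translates the equation between fields into
  one between forms.\<close>

lemma mem_dirac_structure_iff: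
  assumes B: "module_automorphism A B" and Z: "Z \<in> vector_fields A" and \<beta>: "\<beta> \<in> one_forms A"
  shows "(Z, \<beta>) \<in> dirac_structure A g B \<longleftrightarrow> \<beta> + form_action A g B \<beta> = flat A g (Z - B Z)"
proof -
  obtain W where W: "W \<in> vector_fields A" and \<beta>W: "\<beta> = flat A g W"
    using flat_surj[OF \<beta>] by metis
  note BV = module_automorphism_closed[OF B]
  have "(Z, \<beta>) \<in> dirac_structure A g B \<longleftrightarrow>
      (\<exists>X\<in>vector_fields A. Z = X + B X \<and> flat A g W = flat A g (X - B X))"
    by (auto simp: dirac_structure_def \<beta>W dirac_structure_form[OF B])
  also have "\<dots> \<longleftrightarrow> (\<exists>X\<in>vector_fields A. Z = X + B X \<and> W = X - B X)"
    using flat_eq_iff[OF W vector_field_diff] BV by (intro bex_cong refl conj_cong) auto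
  also have "\<dots> \<longleftrightarrow> W + B W = Z - B Z" by (rule module_automorphism_cayley[OF B Z W])
  also have "\<dots> \<longleftrightarrow> flat A g (W + B W) = flat A g (Z - B Z)"
    using flat_eq_iff W Z BV vector_field_add vector_field_diff by metis
  also have "flat A g (W + B W) = \<beta> + form_action A g B \<beta>"
    using W BV by (simp add: \<beta>W form_action_flat flat_add)
  finally show ?thesis .
qed

end

theorem lemma4p3:
  fixes M :: "'m topology"
    and A :: "('m, 'e::euclidean_space) atlas"
    and g :: "('m, 'e) metric"
    and B :: "('m, 'e) vfield \<Rightarrow> ('m, 'e) vfield"
  assumes "smooth_manifold M A"
    and "riemannian_metric A g"
    and "orthogonal_automorphism A g B"
  shows "(\<forall>(X, \<omega>) \<in> dirac_structure A g B. \<forall>(Y, \<mu>) \<in> dirac_structure A g B.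
            (lie_bracket A X Y, form_bracket A (X, \<omega>) (Y, \<mu>)) \<in> dirac_structure A g B)
     \<longleftrightarrow>
         (\<forall>X \<in> vector_fields A. \<forall>Y \<in> vector_fields A.
            let \<omega>X = flat A g X - form_action A g B (flat A g X);
                \<omega>Y = flat A g Y - form_action A g B (flat A g Y);
                \<beta> = form_bracket A (X + B X, \<omega>X) (Y + B Y, \<omega>Y);
                Z = lie_bracket A (X + B X) (Y + B Y)
            in \<beta> + form_action A g B \<beta> = flat A g (Z - B Z))"
proof -
  interpret riemannian_atlas_manifold M A g
    using assms(1,2) by unfold_locales
  have B: "module_automorphism A B" using assms(3) by (simp add: orthogonal_automorphism_def)
  define \<omega> where "\<omega> X = flat A g X - form_action A g B (flat A g X)" for X
  \<comment> \<open>Elements of \<open>L\<^sub>B\<close> consist of genuine fields and forms, so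
    their brackets meet the requirements of the membership criterion.\<close>
  have sections: "X + B X \<in> vector_fields A" "\<omega> X \<in> one_forms A" if X: "X \<in> vector_fields A" for X
    using X module_automorphism_closed[OF B X]
    by (auto simp: \<omega>_def dirac_structure_form[OF B] intro: vector_field_add flat_one_form vector_field_diff)
  have "(lie_bracket A (X + B X) (Y + B Y), form_bracket A (X + B X, \<omega> X) (Y + B Y, \<omega> Y)) \<in> dirac_structure A g B
    \<longleftrightarrow> form_bracket A (X + B X, \<omega> X) (Y + B Y, \<omega> Y)
        + form_action A g B (form_bracket A (X + B X, \<omega> X) (Y + B Y, \<omega> Y))
      = flat A g (lie_bracket A (X + B X) (Y + B Y) - B (lie_bracket A (X + B X) (Y + B Y)))"
    if "X \<in> vector_fields A" "Y \<in> vector_fields A" for X Y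
    by (intro mem_dirac_structure_iff B lie_bracket_vector_field form_bracket_one_form sections that)
  \<comment> \<open>Quantification over \<open>L\<^sub>B\<close> is quantification over its
    parameter X. With this, used for both elements, condition (a) ranges over the same pairs of
    fields as (b).\<close>
  moreover have "(\<forall>(X, \<alpha>) \<in> dirac_structure A g B. P X \<alpha>) \<longleftrightarrow> (\<forall>X \<in> vector_fields A. P (X + B X) (\<omega> X))" for P
    unfolding dirac_structure_def \<omega>_def by blast
  ultimately show ?thesis unfolding Let_def by (simp flip: \<omega>_def)
qed

end
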